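(* The following MV-algebras are hopfian: (i) simple MV-algebras; (ii) finitely generated MV-algebras with only finitely many prime ideals; (iii) for every $n=1,2,\ldots$ and every rational point $w$ lying in the interior of the cube $[0,1]^n$, the germinal MV-algebra $\mathcal M([0,1]^n)/\mathfrak o_w$.
   Context: An MV-algebra is an abelian monoid $(A,0,\oplus)$ with a unary operation $\neg$ satisfying $\neg\neg x=x$, $x\oplus\neg 0=\neg 0$ and $\neg(\neg x\oplus y)\oplus y=\neg(\neg y\oplus x)\oplus x$. All MV-algebras are assumed nontrivial. An ideal is the kernel $h^{-1}(0)$ of a homomorphism $h$; ideals are assumed proper. An ideal $\mathfrak p$ of $A$ is prime if $A/\mathfrak p$ is totally ordered. $A$ is simple if $\{0\}$ is its only proper ideal. $\mathcal M([0,1]^n)$ is the MV-algebra, with pointwise operations $\neg x=1-x$, $x\oplus y=\min(1,x+y)$, of all McNaughton functions on $[0,1]^n$: continuous functions $f\colon[0,1]^n\to[0,1]$ for which there are affine linear polynomials $p_1,\dots,p_u$ with integer coefficients such that for each $x\in[0,1]^n$ there is $j$ with $f(x)=p_j(x)$. For $x\in[0,1]^n$, $\mathfrak o_x$ is the ideal of all $f\in\mathcal M([0,1]^n)$ that vanish identically over some open neighborhood of $x$. A point is rational if all its coordinates are rational. $A$ is hopfian if every homomorphism of $A$ onto $A$ is an automorphism. *)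

theory Defs
  imports "HOL-Analysis.Analysis" "HOL-Algebra.Group"
begin

section \<open>MV-algebras\<close>

record 'a mv_struct = "'a partial_object" +
  mv_zero :: 'a  (\<open>\<zero>\<index>\<close>)
  mv_plus :: "'a \<Rightarrow> 'a \<Rightarrow> 'a"  (infixl \<open>\<oplus>\<index>\<close> 65)
  mv_neg :: "'a \<Rightarrow> 'a"  (\<open>\<sim>\<index> _\<close> [81] 80)

definition mv_monoid :: "('a, 'm) mv_struct_scheme \<Rightarrow> 'a monoid" where
  "mv_monoid A = \<lparr>carrier = carrier A, mult = mv_plus A, one = mv_zero A\<rparr>"

text \<open>Nontriviality is part of the notion.\<close>

locale mv_algebra =
  fixes A (structure)
  assumes comm_monoid: "comm_monoid (mv_monoid A)"
    and neg_closed: "x \<in> carrier A \<Longrightarrow> \<sim> x \<in> carrier A"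
    and neg_neg: "x \<in> carrier A \<Longrightarrow> \<sim> (\<sim> x) = x"
    and plus_neg_zero: "x \<in> carrier A \<Longrightarrow> x \<oplus> \<sim> \<zero> = \<sim> \<zero>"
    and mv_axiom: "\<lbrakk>x \<in> carrier A; y \<in> carrier A\<rbrakk>
      \<Longrightarrow> \<sim> (\<sim> x \<oplus> y) \<oplus> y = \<sim> (\<sim> y \<oplus> x) \<oplus> x"
    and nontrivial: "carrier A \<noteq> {\<zero>}"

definition mv_hom :: "('a, 'm) mv_struct_scheme \<Rightarrow> ('b, 'k) mv_struct_scheme \<Rightarrow> ('a \<Rightarrow> 'b) set" where
  "mv_hom A B = {h \<in> carrier A \<rightarrow> carrier B.
     h \<zero>\<^bsub>A\<^esub> = \<zero>\<^bsub>B\<^esub> \<and>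
     (\<forall>x\<in>carrier A. \<forall>y\<in>carrier A. h (x \<oplus>\<^bsub>A\<^esub> y) = h x \<oplus>\<^bsub>B\<^esub> h y) \<and>
     (\<forall>x\<in>carrier A. h (\<sim>\<^bsub>A\<^esub> x) = \<sim>\<^bsub>B\<^esub> h x)}"

text \<open>The inverse of a bijective homomorphism is automatically a homomorphism.\<close>

definition mv_aut :: "('a, 'm) mv_struct_scheme \<Rightarrow> ('a \<Rightarrow> 'a) set" where
  "mv_aut A = {h \<in> mv_hom A A. bij_betw h (carrier A) (carrier A)}"

definition mv_hopfian :: "('a, 'm) mv_struct_scheme \<Rightarrow> bool" where
  "mv_hopfian A \<longleftrightarrow> (\<forall>h\<in>mv_hom A A. h ` carrier A = carrier A \<longrightarrow> h \<in> mv_aut A)"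

definition mv_kernel :: "('a, 'm) mv_struct_scheme \<Rightarrow> ('b, 'k) mv_struct_scheme \<Rightarrow> ('a \<Rightarrow> 'b) \<Rightarrow> 'a set" where
  "mv_kernel A B h = {x \<in> carrier A. h x = \<zero>\<^bsub>B\<^esub>}"

text \<open>
  An ideal is the kernel of a homomorphism; it is proper because the codomain is nontrivial.
  HOL cannot quantify over the element type of the codomain inside a definition. The type
  \<open>'a set\<close> loses no generality: see \<open>mv_kernel_ideal\<close> below.
\<close>

definition mv_ideal :: "('a, 'm) mv_struct_scheme \<Rightarrow> 'a set \<Rightarrow> bool" where
  "mv_ideal A I \<longleftrightarrow>
     (\<exists>(B :: 'a set mv_struct) h. mv_algebra B \<and> h \<in> mv_hom A B \<and> I = mv_kernel A B h)"

context mv_algebra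
begin

lemma zero_closed: "\<zero> \<in> carrier A"
  using comm_monoid.axioms(1)[OF comm_monoid] monoid.one_closed[of "mv_monoid A"]
  by (simp add: mv_monoid_def)

lemma plus_closed: "\<lbrakk>x \<in> carrier A; y \<in> carrier A\<rbrakk> \<Longrightarrow> x \<oplus> y \<in> carrier A"
  using comm_monoid.axioms(1)[OF comm_monoid] monoid.m_closed[of "mv_monoid A" x y]
  by (simp add: mv_monoid_def)

lemma plus_assoc:
  "\<lbrakk>x \<in> carrier A; y \<in> carrier A; z \<in> carrier A\<rbrakk> \<Longrightarrow> (x \<oplus> y) \<oplus> z = x \<oplus> (y \<oplus> z)"
  using comm_monoid.axioms(1)[OF comm_monoid] monoid.m_assoc[of "mv_monoid A" x y z]
  by (simp add: mv_monoid_def)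

lemma plus_comm: "\<lbrakk>x \<in> carrier A; y \<in> carrier A\<rbrakk> \<Longrightarrow> x \<oplus> y = y \<oplus> x"
  using comm_monoid.m_comm[OF comm_monoid, of x y] by (simp add: mv_monoid_def)

lemma zero_plus: "x \<in> carrier A \<Longrightarrow> \<zero> \<oplus> x = x"
  using comm_monoid.axioms(1)[OF comm_monoid] monoid.l_one[of "mv_monoid A" x]
  by (simp add: mv_monoid_def)

lemma neg_zero_neq_zero: "\<sim> \<zero> \<noteq> \<zero>"
proof
  assume eq: "\<sim> \<zero> = \<zero>"
  have "x = \<zero>" if x: "x \<in> carrier A" for x
    using plus_neg_zero[OF x] zero_plus[OF x] plus_comm[OF x zero_closed] eq by simp
  then show False using nontrivial zero_closed by blast
qed

end

lemma mv_algebraI: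
  assumes "\<zero>\<^bsub>A\<^esub> \<in> carrier A"
    and "\<And>x y. \<lbrakk>x \<in> carrier A; y \<in> carrier A\<rbrakk> \<Longrightarrow> x \<oplus>\<^bsub>A\<^esub> y \<in> carrier A"
    and "\<And>x. x \<in> carrier A \<Longrightarrow> \<sim>\<^bsub>A\<^esub> x \<in> carrier A"
    and "\<And>x y z. \<lbrakk>x \<in> carrier A; y \<in> carrier A; z \<in> carrier A\<rbrakk>
      \<Longrightarrow> (x \<oplus>\<^bsub>A\<^esub> y) \<oplus>\<^bsub>A\<^esub> z = x \<oplus>\<^bsub>A\<^esub> (y \<oplus>\<^bsub>A\<^esub> z)"
    and "\<And>x y. \<lbrakk>x \<in> carrier A; y \<in> carrier A\<rbrakk> \<Longrightarrow> x \<oplus>\<^bsub>A\<^esub> y = y \<oplus>\<^bsub>A\<^esub> x"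
    and "\<And>x. x \<in> carrier A \<Longrightarrow> \<zero>\<^bsub>A\<^esub> \<oplus>\<^bsub>A\<^esub> x = x"
    and "\<And>x. x \<in> carrier A \<Longrightarrow> \<sim>\<^bsub>A\<^esub> (\<sim>\<^bsub>A\<^esub> x) = x"
    and "\<And>x. x \<in> carrier A \<Longrightarrow> x \<oplus>\<^bsub>A\<^esub> \<sim>\<^bsub>A\<^esub> \<zero>\<^bsub>A\<^esub> = \<sim>\<^bsub>A\<^esub> \<zero>\<^bsub>A\<^esub>"
    and "\<And>x y. \<lbrakk>x \<in> carrier A; y \<in> carrier A\<rbrakk>
      \<Longrightarrow> \<sim>\<^bsub>A\<^esub> (\<sim>\<^bsub>A\<^esub> x \<oplus>\<^bsub>A\<^esub> y) \<oplus>\<^bsub>A\<^esub> y = \<sim>\<^bsub>A\<^esub> (\<sim>\<^bsub>A\<^esub> y \<oplus>\<^bsub>A\<^esub> x) \<oplus>\<^bsub>A\<^esub> x"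
    and "\<sim>\<^bsub>A\<^esub> \<zero>\<^bsub>A\<^esub> \<noteq> \<zero>\<^bsub>A\<^esub>"
  shows "mv_algebra A"
proof (rule mv_algebra.intro)
  show "comm_monoid (mv_monoid A)"
    by (rule comm_monoidI) (simp_all add: mv_monoid_def assms(1,2,4,6), rule assms(5))
  show "carrier A \<noteq> {\<zero>\<^bsub>A\<^esub>}"
    using assms(3)[OF assms(1)] assms(10) by (metis singletonD)
qed (fact assms(3) assms(7) assms(8) assms(9))+

lemma mv_kernel_ideal:
  fixes A :: "('a, 'm) mv_struct_scheme" and B :: "('b, 'k) mv_struct_scheme"
  assumes A: "mv_algebra A" and B: "mv_algebra B" and h: "h \<in> mv_hom A B"
  shows "mv_ideal A (mv_kernel A B h)"
proof -
  interpret A: mv_algebra A by fact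
  interpret B: mv_algebra B by fact
  define fib where "fib b = {a \<in> carrier A. h a = b}" for b
  define val where "val X = h (SOME a. a \<in> X)" for X
  define g where "g x = fib (h x)" for x
  define C where "C = \<lparr>carrier = g ` carrier A, mv_zero = g \<zero>\<^bsub>A\<^esub>,
    mv_plus = (\<lambda>X Y. fib (val X \<oplus>\<^bsub>B\<^esub> val Y)), mv_neg = (\<lambda>X. fib (\<sim>\<^bsub>B\<^esub> val X))\<rparr>"
  have hc: "h x \<in> carrier B" if "x \<in> carrier A" for x
    using h that by (auto simp: mv_hom_def)
  have h0: "h \<zero>\<^bsub>A\<^esub> = \<zero>\<^bsub>B\<^esub>" using h by (simp add: mv_hom_def)
  have hp: "h (x \<oplus>\<^bsub>A\<^esub> y) = h x \<oplus>\<^bsub>B\<^esub> h y" if "x \<in> carrier A" "y \<in> carrier A" for x y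
    using h that by (simp add: mv_hom_def)
  have hn: "h (\<sim>\<^bsub>A\<^esub> x) = \<sim>\<^bsub>B\<^esub> h x" if "x \<in> carrier A" for x
    using h that by (simp add: mv_hom_def)
  have val: "val (g x) = h x" if "x \<in> carrier A" for x
  proof -
    have "x \<in> g x" using that by (simp add: g_def fib_def)
    then have "(SOME a. a \<in> g x) \<in> g x" by (rule someI)
    then show ?thesis by (simp add: val_def g_def fib_def)
  qed
  have gp: "g x \<oplus>\<^bsub>C\<^esub> g y = g (x \<oplus>\<^bsub>A\<^esub> y)" if "x \<in> carrier A" "y \<in> carrier A" for x y
    using that by (simp add: C_def val hp) (simp add: g_def hp)
  have gn: "\<sim>\<^bsub>C\<^esub> g x = g (\<sim>\<^bsub>A\<^esub> x)" if "x \<in> carrier A" for x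
    using that by (simp add: C_def val) (simp add: g_def hn)
  have g0: "\<zero>\<^bsub>C\<^esub> = g \<zero>\<^bsub>A\<^esub>" and gc: "carrier C = g ` carrier A"
    by (simp_all add: C_def)
  have geq: "g x = g y \<longleftrightarrow> h x = h y" if "x \<in> carrier A" "y \<in> carrier A" for x y
    using val[OF that(1)] val[OF that(2)] unfolding g_def by metis
  have C: "mv_algebra C"
  proof (rule mv_algebraI)
    show "\<sim>\<^bsub>C\<^esub> \<zero>\<^bsub>C\<^esub> \<noteq> \<zero>\<^bsub>C\<^esub>"
      using B.neg_zero_neq_zero
      by (simp add: g0 gn geq A.zero_closed A.neg_closed hn h0)
  next
    fix X Y Z assume XYZ: "X \<in> carrier C" "Y \<in> carrier C" "Z \<in> carrier C"
    show "(X \<oplus>\<^bsub>C\<^esub> Y) \<oplus>\<^bsub>C\<^esub> Z = X \<oplus>\<^bsub>C\<^esub> (Y \<oplus>\<^bsub>C\<^esub> Z)"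
      using XYZ by (auto simp: gc gp A.plus_closed A.plus_assoc)
  next
    fix X Y assume XY: "X \<in> carrier C" "Y \<in> carrier C"
    then obtain x y where x: "x \<in> carrier A" "X = g x" and y: "y \<in> carrier A" "Y = g y"
      by (auto simp: gc)
    show "X \<oplus>\<^bsub>C\<^esub> Y \<in> carrier C"
      using x y by (simp add: gc gp A.plus_closed)
    show "X \<oplus>\<^bsub>C\<^esub> Y = Y \<oplus>\<^bsub>C\<^esub> X"
      using x y A.plus_comm[of x y] by (simp add: gp)
    show "\<sim>\<^bsub>C\<^esub> (\<sim>\<^bsub>C\<^esub> X \<oplus>\<^bsub>C\<^esub> Y) \<oplus>\<^bsub>C\<^esub> Y = \<sim>\<^bsub>C\<^esub> (\<sim>\<^bsub>C\<^esub> Y \<oplus>\<^bsub>C\<^esub> X) \<oplus>\<^bsub>C\<^esub> X"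
      using x y A.mv_axiom[of x y] by (simp add: gp gn A.neg_closed A.plus_closed)
  next
    fix X assume "X \<in> carrier C"
    then obtain x where x: "x \<in> carrier A" "X = g x" by (auto simp: gc)
    show "\<sim>\<^bsub>C\<^esub> X \<in> carrier C"
      using x by (simp add: gc gn A.neg_closed)
    show "\<zero>\<^bsub>C\<^esub> \<oplus>\<^bsub>C\<^esub> X = X"
      using x by (simp add: g0 gp A.zero_closed A.zero_plus)
    show "\<sim>\<^bsub>C\<^esub> (\<sim>\<^bsub>C\<^esub> X) = X"
      using x by (simp add: gn A.neg_closed A.neg_neg)
    show "X \<oplus>\<^bsub>C\<^esub> \<sim>\<^bsub>C\<^esub> \<zero>\<^bsub>C\<^esub> = \<sim>\<^bsub>C\<^esub> \<zero>\<^bsub>C\<^esub>"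
      using x by (simp add: g0 gp gn A.zero_closed A.neg_closed A.plus_neg_zero)
  next
    show "\<zero>\<^bsub>C\<^esub> \<in> carrier C"
      by (simp add: g0 gc A.zero_closed)
  qed
  have "g \<in> mv_hom A C"
    by (auto simp: mv_hom_def gc g0 gp gn)
  moreover have "mv_kernel A B h = mv_kernel A C g"
    by (simp add: mv_kernel_def g0 geq A.zero_closed h0 cong: conj_cong)
  ultimately show ?thesis
    unfolding mv_ideal_def by (intro exI[of _ C] exI[of _ g] conjI C)
qed

definition mv_simple :: "('a, 'm) mv_struct_scheme \<Rightarrow> bool" where
  "mv_simple A \<longleftrightarrow> (\<forall>I. mv_ideal A I \<longleftrightarrow> I = {\<zero>\<^bsub>A\<^esub>})"

text \<open>The order of an MV-algebra: \<open>x \<le> y\<close> iff \<open>\<not>x \<oplus> y = 1\<close>, where \<open>1 = \<not>0\<close>.\<close>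

definition mv_le :: "('a, 'm) mv_struct_scheme \<Rightarrow> 'a \<Rightarrow> 'a \<Rightarrow> bool" where
  "mv_le A x y \<longleftrightarrow> \<sim>\<^bsub>A\<^esub> x \<oplus>\<^bsub>A\<^esub> y = \<sim>\<^bsub>A\<^esub> \<zero>\<^bsub>A\<^esub>"

definition mv_totally_ordered :: "('a, 'm) mv_struct_scheme \<Rightarrow> bool" where
  "mv_totally_ordered A \<longleftrightarrow> (\<forall>x\<in>carrier A. \<forall>y\<in>carrier A. mv_le A x y \<or> mv_le A y x)"

text \<open>
  Quotients use the congruence given by the Chang distance
  \<open>d(x,y) = (x \<ominus> y) \<oplus> (y \<ominus> x)\<close>, where \<open>x \<ominus> y = \<not>(\<not>x \<oplus> y)\<close>.
\<close>

definition mv_dist :: "('a, 'm) mv_struct_scheme \<Rightarrow> 'a \<Rightarrow> 'a \<Rightarrow> 'a" where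
  "mv_dist A x y = \<sim>\<^bsub>A\<^esub> (\<sim>\<^bsub>A\<^esub> x \<oplus>\<^bsub>A\<^esub> y) \<oplus>\<^bsub>A\<^esub> \<sim>\<^bsub>A\<^esub> (\<sim>\<^bsub>A\<^esub> y \<oplus>\<^bsub>A\<^esub> x)"

definition mv_cong :: "('a, 'm) mv_struct_scheme \<Rightarrow> 'a set \<Rightarrow> 'a rel" where
  "mv_cong A I = {(x, y) \<in> carrier A \<times> carrier A. mv_dist A x y \<in> I}"

definition mv_quot :: "('a, 'm) mv_struct_scheme \<Rightarrow> 'a set \<Rightarrow> 'a set mv_struct" where
  "mv_quot A I =
     \<lparr>carrier = carrier A // mv_cong A I,
      mv_zero = mv_cong A I `` {\<zero>\<^bsub>A\<^esub>},
      mv_plus = (\<lambda>X Y. \<Union>x\<in>X. \<Union>y\<in>Y. mv_cong A I `` {x \<oplus>\<^bsub>A\<^esub> y}),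
      mv_neg = (\<lambda>X. \<Union>x\<in>X. mv_cong A I `` {\<sim>\<^bsub>A\<^esub> x})\<rparr>"

definition mv_prime_ideal :: "('a, 'm) mv_struct_scheme \<Rightarrow> 'a set \<Rightarrow> bool" where
  "mv_prime_ideal A P \<longleftrightarrow> mv_ideal A P \<and> mv_totally_ordered (mv_quot A P)"

inductive_set mv_generate :: "('a, 'm) mv_struct_scheme \<Rightarrow> 'a set \<Rightarrow> 'a set"
  for A and X where
  incl: "x \<in> X \<Longrightarrow> x \<in> mv_generate A X"
| zero: "\<zero>\<^bsub>A\<^esub> \<in> mv_generate A X"
| plus: "\<lbrakk>x \<in> mv_generate A X; y \<in> mv_generate A X\<rbrakk> \<Longrightarrow> x \<oplus>\<^bsub>A\<^esub> y \<in> mv_generate A X"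
| neg: "x \<in> mv_generate A X \<Longrightarrow> \<sim>\<^bsub>A\<^esub> x \<in> mv_generate A X"

definition mv_finitely_generated :: "('a, 'm) mv_struct_scheme \<Rightarrow> bool" where
  "mv_finitely_generated A \<longleftrightarrow>
     (\<exists>X. finite X \<and> X \<subseteq> carrier A \<and> mv_generate A X = carrier A)"

section \<open>McNaughton functions\<close>

definition unit_cube :: "(real ^ 'n) set" where
  "unit_cube = {x. \<forall>i. 0 \<le> x $ i \<and> x $ i \<le> 1}"

definition int_affine :: "(real ^ 'n \<Rightarrow> real) \<Rightarrow> bool" where
  "int_affine p \<longleftrightarrow>
     (\<exists>(a :: 'n \<Rightarrow> int) (b :: int). \<forall>x. p x = (\<Sum>i\<in>UNIV. of_int (a i) * x $ i) + of_int b)"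

text \<open>
  Functions on the cube are represented as HOL functions in \<open>extensional unit_cube\<close>,
  so that equality of functions is equality on the cube.
\<close>

definition mcnaughton_functions :: "(real ^ 'n \<Rightarrow> real) set" where
  "mcnaughton_functions = {f \<in> unit_cube \<rightarrow>\<^sub>E {0..1}. continuous_on unit_cube f \<and>
     (\<exists>P. finite P \<and> (\<forall>p\<in>P. int_affine p) \<and> (\<forall>x\<in>unit_cube. \<exists>p\<in>P. f x = p x))}"

definition mcnaughton :: "(real ^ 'n \<Rightarrow> real) mv_struct" where
  "mcnaughton =
     \<lparr>carrier = mcnaughton_functions,
      mv_zero = (\<lambda>x\<in>unit_cube. 0),
      mv_plus = (\<lambda>f g. \<lambda>x\<in>unit_cube. min 1 (f x + g x)),
      mv_neg = (\<lambda>f. \<lambda>x\<in>unit_cube. 1 - f x)\<rparr>"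

definition germ_ideal :: "real ^ 'n \<Rightarrow> (real ^ 'n \<Rightarrow> real) set" where
  "germ_ideal x = {f \<in> mcnaughton_functions.
     \<exists>U. openin (top_of_set unit_cube) U \<and> x \<in> U \<and> (\<forall>y\<in>U. f y = 0)}"

definition rational_point :: "real ^ 'n \<Rightarrow> bool" where
  "rational_point x \<longleftrightarrow> (\<forall>i. x $ i \<in> \<rat>)"

end

theory Submission
  imports Defs
begin

text \<open>
  A homomorphism with trivial kernel is injective, because \<open>x = y\<close> iff their Chang distance
  vanishes. For simple algebras the kernel has no choice. For algebras with finite prime
  spectrum, taking preimages permutes the spectrum, so the kernel lies in every prime ideal,
  and the intersection of all prime ideals is zero. For the germinal algebra at \<open>w\<close>, McNaughton's
  theorem shows that an endomorphism is composition with a piecewise linear map \<open>G\<close>; since it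
  sends zero to zero, \<open>G w = w\<close>. Surjectivity yields a left inverse of \<open>G\<close> near \<open>w\<close>, so \<open>G\<close> is
  open there by invariance of domain, and \<open>f \<circ> G = 0\<close> near \<open>w\<close> forces \<open>f = 0\<close> near \<open>w\<close>.
\<close>

section \<open>Arithmetic of MV-algebras\<close>

text \<open>Kernels are awkward to construct with, since \<open>mv_ideal\<close> quantifies over
  whole structures; so ideals are handled as down-closed, \<oplus>-closed sets, and primality as a
  condition on the differences x \<ominus> y and y \<ominus> x. The primes meet in zero because an
  ideal that Zorn's lemma makes maximal among those missing a nonzero \<open>a\<close> is prime:
  multiples of the two differences have no common lower bound but zero. For germs the obstacle is
  that a homomorphism is controlled only on generators, while McNaughton functions are given by
  continuity and affine pieces. McNaughton's theorem bridges this, here without triangulations: a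
  max-min formula whose one delicate inequality is checked along segments. If \<open>G w\<close>
  differed from \<open>w\<close>, a truncated integral affine function would vanish near
  \<open>w\<close> and be positive at \<open>G w\<close>; its germ is zero, yet the image would be
  nonzero at \<open>w\<close>. Since \<open>w\<close> is interior, germs live on open sets of the
  full space and \<open>G\<close> maps between equal dimensions, as invariance of domain
  demands.\<close>

context mv_algebra
begin

abbreviation minus (infixl \<open>\<ominus>\<close> 65) where "x \<ominus> y \<equiv> \<sim> (\<sim> x \<oplus> y)"

abbreviation le (infix \<open>\<preceq>\<close> 50) where "x \<preceq> y \<equiv> mv_le A x y"

lemmas closed [simp, intro] = zero_closed plus_closed neg_closed

lemma plus_zero: "x \<in> carrier A \<Longrightarrow> x \<oplus> \<zero> = x"
  using plus_comm[of x \<zero>] by (simp add: zero_plus)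

lemma plus_left_comm:
  "\<lbrakk>x \<in> carrier A; y \<in> carrier A; z \<in> carrier A\<rbrakk> \<Longrightarrow> x \<oplus> (y \<oplus> z) = y \<oplus> (x \<oplus> z)"
  using plus_assoc[of x y z] plus_assoc[of y x z] plus_comm[of x y] by simp

lemma top_plus: "x \<in> carrier A \<Longrightarrow> \<sim> \<zero> \<oplus> x = \<sim> \<zero>"
  using plus_comm[of "\<sim> \<zero>" x] by (simp add: plus_neg_zero)

text \<open>In the MV axiom for \<open>\<sim> \<zero>\<close> and \<open>x\<close>, one side becomes
  \<open>\<sim> x \<oplus> x\<close> and the other ends in the absorbing summand
  \<open>\<sim> \<zero>\<close>.\<close>

lemma neg_plus: "x \<in> carrier A \<Longrightarrow> \<sim> x \<oplus> x = \<sim> \<zero>"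
  using mv_axiom[of "\<sim> \<zero>" x] by (simp add: neg_neg zero_plus plus_neg_zero)

lemma le_refl [simp]: "x \<in> carrier A \<Longrightarrow> x \<preceq> x"
  by (simp add: mv_le_def neg_plus)

lemma zero_le [simp]: "x \<in> carrier A \<Longrightarrow> \<zero> \<preceq> x"
  by (simp add: mv_le_def top_plus)

lemma le_top [simp]: "x \<in> carrier A \<Longrightarrow> x \<preceq> \<sim> \<zero>"
  by (simp add: mv_le_def plus_neg_zero)

lemma minus_zero: "x \<in> carrier A \<Longrightarrow> x \<ominus> \<zero> = x"
  by (simp add: plus_zero neg_neg)

lemma zero_minus: "x \<in> carrier A \<Longrightarrow> \<zero> \<ominus> x = \<zero>"
  by (simp add: top_plus neg_neg)

text \<open>Residuation, immediate from double negation and associativity; it is the usual way below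
  to move a term across an inequality.\<close>

lemma minus_le_iff:
  assumes "x \<in> carrier A" "y \<in> carrier A" "z \<in> carrier A"
  shows "x \<ominus> y \<preceq> z \<longleftrightarrow> x \<preceq> y \<oplus> z"
  using assms by (simp add: mv_le_def neg_neg plus_assoc)

lemma neg_eq_iff:
  assumes "x \<in> carrier A" "y \<in> carrier A"
  shows "\<sim> x = \<sim> y \<longleftrightarrow> x = y"
  by (metis neg_neg assms)

lemma minus_eq_zero_iff:
  assumes "x \<in> carrier A" "y \<in> carrier A"
  shows "x \<ominus> y = \<zero> \<longleftrightarrow> x \<preceq> y"
  using assms neg_eq_iff[of "x \<ominus> y" \<zero>] by (simp add: mv_le_def neg_neg)

lemma minus_plus_comm:
  assumes "x \<in> carrier A" "y \<in> carrier A"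
  shows "(x \<ominus> y) \<oplus> y = (y \<ominus> x) \<oplus> x"
  using mv_axiom assms by simp

text \<open>The opposite difference is zero, so one side of the MV axiom is just \<open>y\<close>.
  This exhibits the order as divisibility for \<oplus>, from which transitivity and monotonicity
  follow.\<close>

lemma minus_plus_cancel:
  assumes "x \<in> carrier A" "y \<in> carrier A" "x \<preceq> y"
  shows "(y \<ominus> x) \<oplus> x = y"
  using minus_plus_comm[OF assms(1,2)] minus_eq_zero_iff[OF assms(1,2)] assms
  by (simp add: zero_plus)

lemma le_antisym:
  assumes "x \<in> carrier A" "y \<in> carrier A" "x \<preceq> y" "y \<preceq> x"
  shows "x = y"
  using minus_plus_cancel[OF assms(1-3)] minus_eq_zero_iff[OF assms(2,1)] assms
  by (simp add: zero_plus)

lemma le_plus: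
  assumes "x \<in> carrier A" "y \<in> carrier A"
  shows "x \<preceq> y \<oplus> x" "x \<preceq> x \<oplus> y"
proof -
  show "x \<preceq> y \<oplus> x"
    using assms by (simp add: mv_le_def plus_left_comm[of _ y] neg_plus plus_neg_zero)
  then show "x \<preceq> x \<oplus> y" using assms plus_comm by simp
qed

lemma le_trans:
  assumes "x \<in> carrier A" "y \<in> carrier A" "z \<in> carrier A" "x \<preceq> y" "y \<preceq> z"
  shows "x \<preceq> z"
proof -
  have "z = (z \<ominus> y) \<oplus> ((y \<ominus> x) \<oplus> x)"
    using minus_plus_cancel[of y z] minus_plus_cancel[of x y] assms by simp
  also have "\<dots> = ((z \<ominus> y) \<oplus> (y \<ominus> x)) \<oplus> x"
    using assms by (simp add: plus_assoc)
  finally show ?thesis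
    using le_plus(1)[of x "(z \<ominus> y) \<oplus> (y \<ominus> x)"] assms by simp
qed

lemma plus_mono_right:
  assumes "x \<in> carrier A" "y \<in> carrier A" "z \<in> carrier A" "x \<preceq> y"
  shows "z \<oplus> x \<preceq> z \<oplus> y"
proof -
  have "z \<oplus> y = (y \<ominus> x) \<oplus> (z \<oplus> x)"
    using minus_plus_cancel[of x y] assms plus_left_comm[of z "y \<ominus> x" x] by simp
  then show ?thesis
    using le_plus(1)[of "z \<oplus> x" "y \<ominus> x"] assms by simp
qed

lemma plus_mono:
  assumes "x \<in> carrier A" "y \<in> carrier A" "u \<in> carrier A" "v \<in> carrier A"
    and "x \<preceq> y" "u \<preceq> v"
  shows "x \<oplus> u \<preceq> y \<oplus> v"
  using plus_mono_right[of u v x] plus_mono_right[of x y v] assms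
    plus_comm[of x v] plus_comm[of y v] le_trans[of "x \<oplus> u" "x \<oplus> v" "y \<oplus> v"] by simp

lemma minus_le:
  assumes "x \<in> carrier A" "y \<in> carrier A"
  shows "x \<ominus> y \<preceq> x"
  using assms by (simp add: minus_le_iff le_plus)

lemma le_plus_minus:
  assumes "x \<in> carrier A" "y \<in> carrier A"
  shows "x \<preceq> y \<oplus> (x \<ominus> y)"
  using minus_le_iff[of x y "x \<ominus> y"] assms by simp

lemma neg_le_neg_iff:
  assumes "x \<in> carrier A" "y \<in> carrier A"
  shows "\<sim> x \<preceq> \<sim> y \<longleftrightarrow> y \<preceq> x"
  using assms by (simp add: mv_le_def neg_neg plus_comm)

lemma neg_minus_neg:
  assumes "x \<in> carrier A" "y \<in> carrier A"
  shows "\<sim> x \<ominus> \<sim> y = y \<ominus> x"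
  using assms by (simp add: neg_neg plus_comm)

lemma minus_antimono:
  assumes "x \<in> carrier A" "y \<in> carrier A" "z \<in> carrier A" "x \<preceq> y"
  shows "z \<ominus> y \<preceq> z \<ominus> x"
  using plus_mono_right[of x y "\<sim> z"] assms by (simp add: neg_le_neg_iff)

lemma minus_mono:
  assumes "x \<in> carrier A" "y \<in> carrier A" "z \<in> carrier A" "x \<preceq> y"
  shows "x \<ominus> z \<preceq> y \<ominus> z"
  using minus_antimono[of "\<sim> y" "\<sim> x" "\<sim> z"] assms by (simp add: neg_minus_neg neg_le_neg_iff)

text \<open>Replacing \<open>x\<close> by \<open>z\<close> in the difference can only increase it,
  and adding \<open>y\<close> back then restores \<open>z\<close>. The term is the join of
  \<open>x\<close> and \<open>y\<close>; its dual gives meets.\<close>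

lemma sup_least:
  assumes "x \<in> carrier A" "y \<in> carrier A" "z \<in> carrier A" "x \<preceq> z" "y \<preceq> z"
  shows "(x \<ominus> y) \<oplus> y \<preceq> z"
  using plus_mono[of "x \<ominus> y" "z \<ominus> y" y y] minus_mono[of x z y] minus_plus_cancel[of y z] assms
  by simp

lemma inf_greatest:
  assumes "x \<in> carrier A" "y \<in> carrier A" "z \<in> carrier A" "z \<preceq> x" "z \<preceq> y"
  shows "z \<preceq> x \<ominus> (x \<ominus> y)"
proof -
  have "(\<sim> y \<ominus> \<sim> x) \<oplus> \<sim> x \<preceq> \<sim> z"
    using sup_least[of "\<sim> y" "\<sim> x" "\<sim> z"] assms by (simp add: neg_le_neg_iff)
  then have "\<sim> x \<oplus> (x \<ominus> y) \<preceq> \<sim> z"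
    using assms by (simp add: neg_minus_neg plus_comm[of "\<sim> x" "x \<ominus> y"])
  then show ?thesis
    using assms neg_le_neg_iff[of "x \<ominus> (x \<ominus> y)" z] by (simp add: neg_neg)
qed

text \<open>The hypothesis says that the sum is not truncated. Dually
  \<open>y \<preceq> \<sim> x\<close>, and cancelling \<open>y\<close> inside
  \<open>\<sim> x\<close> gives the claim after negation.\<close>

lemma plus_minus_cancel:
  assumes "x \<in> carrier A" "y \<in> carrier A" "x \<preceq> \<sim> y"
  shows "(x \<oplus> y) \<ominus> y = x"
proof -
  have "y \<preceq> \<sim> x"
    using assms neg_le_neg_iff[of x "\<sim> y"] by (metis neg_neg neg_closed neg_le_neg_iff)
  then have "(\<sim> x \<ominus> y) \<oplus> y = \<sim> x"
    using minus_plus_cancel[of y "\<sim> x"] assms by simp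
  then show ?thesis using assms by (simp add: neg_neg)
qed

lemma minus_minus_comm:
  assumes "x \<in> carrier A" "y \<in> carrier A"
  shows "x \<ominus> (x \<ominus> y) = y \<ominus> (y \<ominus> x)"
  using minus_plus_comm[of "\<sim> y" "\<sim> x"] assms
  by (simp add: neg_minus_neg plus_comm[of "\<sim> x" "x \<ominus> y"] plus_comm[of "\<sim> y" "y \<ominus> x"])

text \<open>
  With \<open>m = x \<and> y\<close>, a common lower bound \<open>c\<close> satisfies \<open>m \<oplus> c \<le> m\<close> and \<open>c \<le> \<not> m\<close>,
  so \<open>c = (c \<oplus> m) \<ominus> m = 0\<close>.
\<close>
lemma minus_disjoint:
  assumes x: "x \<in> carrier A" and y: "y \<in> carrier A" and c: "c \<in> carrier A"
    and 1: "c \<preceq> x \<ominus> y" and 2: "c \<preceq> y \<ominus> x"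
  shows "c = \<zero>"
proof -
  define m where "m = x \<ominus> (x \<ominus> y)"
  have mc: "m \<in> carrier A" using x y by (simp add: m_def)
  have my: "m = y \<ominus> (y \<ominus> x)" using minus_minus_comm x y by (simp add: m_def)
  \<comment> \<open>Since \<open>c\<close> fits under \<open>z \<ominus> t\<close>, the meet of
    \<open>z\<close> and \<open>t\<close> fits under \<open>z \<ominus> c\<close>, so adding
    \<open>c\<close> to it does not pass \<open>z\<close>.\<close>
  have cm: "c \<oplus> (z \<ominus> (z \<ominus> t)) \<preceq> z"
    if zt: "z \<in> carrier A" "t \<in> carrier A" "c \<preceq> z \<ominus> t" for z t
  proof -
    have "c \<preceq> z" using le_trans[of c "z \<ominus> t" z] minus_le[of z t] zt c by simp
    then have "(z \<ominus> c) \<oplus> c = z" using minus_plus_cancel zt c by simp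
    moreover have "z \<ominus> (z \<ominus> t) \<preceq> z \<ominus> c"
      using minus_antimono[of c "z \<ominus> t" z] zt c by simp
    ultimately show ?thesis
      using plus_mono_right[of "z \<ominus> (z \<ominus> t)" "z \<ominus> c" c] zt c plus_comm[of c "z \<ominus> c"]
      by simp
  qed
  have "c \<oplus> m \<preceq> x" using cm[of x y] x y 1 by (simp add: m_def)
  moreover have "c \<oplus> m \<preceq> y" using cm[of y x] x y 2 by (simp add: my)
  ultimately have "c \<oplus> m \<preceq> m"
    using inf_greatest[of x y "c \<oplus> m"] x y c mc by (simp add: m_def)
  then have z: "(c \<oplus> m) \<ominus> m = \<zero>" using minus_eq_zero_iff[of "c \<oplus> m" m] c mc by simp
  have "x \<ominus> y \<preceq> \<sim> y"
    using x y by (simp add: neg_le_neg_iff le_plus)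
  moreover have "\<sim> y \<preceq> \<sim> m"
    using minus_le[of y "y \<ominus> x"] x y mc by (simp add: my neg_le_neg_iff)
  ultimately have "c \<preceq> \<sim> m"
    using le_trans[of c "x \<ominus> y" "\<sim> y"] le_trans[of c "\<sim> y" "\<sim> m"] 1 c x y mc by simp
  then show ?thesis using plus_minus_cancel[of c m] z c mc by simp
qed

section \<open>Multiples of disjoint elements\<close>

fun times :: "nat \<Rightarrow> 'a \<Rightarrow> 'a" where
  "times 0 u = \<zero>"
| "times (Suc n) u = u \<oplus> times n u"

lemma times_closed [simp]: "u \<in> carrier A \<Longrightarrow> times n u \<in> carrier A"
  by (induction n) auto

lemma times_add:
  "u \<in> carrier A \<Longrightarrow> times (m + n) u = times m u \<oplus> times n u"
  by (induction m) (simp_all add: zero_plus plus_assoc)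

text \<open>Remove one copy of \<open>v\<close> from \<open>c\<close>: what is left lies below
  \<open>u\<close> and below the remaining copies, so it vanishes by induction; hence
  \<open>c\<close> itself lies below \<open>v\<close>.\<close>

lemma disjoint_times:
  assumes u: "u \<in> carrier A" and v: "v \<in> carrier A"
    and dis: "\<And>c. \<lbrakk>c \<in> carrier A; c \<preceq> u; c \<preceq> v\<rbrakk> \<Longrightarrow> c = \<zero>"
  shows "\<lbrakk>c \<in> carrier A; c \<preceq> u; c \<preceq> times n v\<rbrakk> \<Longrightarrow> c = \<zero>"
proof (induction n arbitrary: c)
  case 0
  then show ?case using le_antisym[of c \<zero>] by simp
next
  case (Suc n)
  have "c \<ominus> v \<preceq> times n v"
    using Suc.prems v by (simp add: minus_le_iff)
  moreover have "c \<ominus> v \<preceq> u"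
    using le_trans[of "c \<ominus> v" c u] minus_le[of c v] Suc.prems u v by simp
  ultimately have "c \<ominus> v = \<zero>" using Suc.IH Suc.prems v by simp
  then have "c \<preceq> v" using minus_eq_zero_iff Suc.prems v by simp
  then show ?case using dis Suc.prems by simp
qed

lemma times_disjoint:
  assumes "x \<in> carrier A" "y \<in> carrier A" "c \<in> carrier A"
    and "c \<preceq> times m (x \<ominus> y)" "c \<preceq> times n (y \<ominus> x)"
  shows "c = \<zero>"
proof (rule disjoint_times[of "times m (x \<ominus> y)" "y \<ominus> x" c n])
  fix d assume d: "d \<in> carrier A" "d \<preceq> times m (x \<ominus> y)" "d \<preceq> y \<ominus> x"
  \<comment> \<open>The same lemma with the roles exchanged, so that multiples are allowed on both
    sides.\<close>
  show "d = \<zero>"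
    by (rule disjoint_times[of "y \<ominus> x" "x \<ominus> y" d m]) (use minus_disjoint[of x y] assms d in auto)
qed (use assms in auto)

lemma minus_triangle:
  assumes "x \<in> carrier A" "y \<in> carrier A" "z \<in> carrier A"
  shows "x \<ominus> z \<preceq> (x \<ominus> y) \<oplus> (y \<ominus> z)"
proof -
  have "x \<preceq> (x \<ominus> y) \<oplus> y" using le_plus_minus[of x y] assms plus_comm[of y "x \<ominus> y"] by simp
  moreover have "(x \<ominus> y) \<oplus> y \<preceq> (x \<ominus> y) \<oplus> (z \<oplus> (y \<ominus> z))"
    using plus_mono_right[of y "z \<oplus> (y \<ominus> z)" "x \<ominus> y"] le_plus_minus[of y z] assms by simp
  ultimately have "x \<preceq> z \<oplus> ((x \<ominus> y) \<oplus> (y \<ominus> z))"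
    using le_trans[of x "(x \<ominus> y) \<oplus> y" "z \<oplus> ((x \<ominus> y) \<oplus> (y \<ominus> z))"]
      plus_left_comm[of "x \<ominus> y" z "y \<ominus> z"] assms by simp
  then show ?thesis using assms by (simp add: minus_le_iff)
qed

lemma plus_minus_plus_le:
  assumes "x \<in> carrier A" "y \<in> carrier A" "u \<in> carrier A" "v \<in> carrier A"
  shows "(x \<oplus> u) \<ominus> (y \<oplus> v) \<preceq> (x \<ominus> y) \<oplus> (u \<ominus> v)"
proof -
  have "x \<oplus> u \<preceq> (y \<oplus> (x \<ominus> y)) \<oplus> (v \<oplus> (u \<ominus> v))"
    using plus_mono[of x "y \<oplus> (x \<ominus> y)" u "v \<oplus> (u \<ominus> v)"] le_plus_minus[of x y] le_plus_minus[of u v]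
      assms by simp
  also have "(y \<oplus> (x \<ominus> y)) \<oplus> (v \<oplus> (u \<ominus> v)) = (y \<oplus> v) \<oplus> ((x \<ominus> y) \<oplus> (u \<ominus> v))"
    using assms by (simp add: plus_assoc plus_left_comm[of "x \<ominus> y" v])
  finally show ?thesis using assms by (simp add: minus_le_iff)
qed

lemma mv_dist_eq_zero:
  assumes "x \<in> carrier A" "y \<in> carrier A" "mv_dist A x y = \<zero>"
  shows "x = y"
proof -
  have "x \<ominus> y = \<zero>" "y \<ominus> x = \<zero>"
    using le_plus[of "x \<ominus> y" "y \<ominus> x"] le_plus[of "y \<ominus> x" "x \<ominus> y"] assms
    by (auto simp: mv_dist_def intro!: le_antisym)
  then show ?thesis using minus_eq_zero_iff assms le_antisym by simp
qed

end

section \<open>Ideals and quotients\<close>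

text \<open>Ideals in intrinsic terms, so that unions of chains and preimages can be tested
  elementwise. The whole carrier qualifies; properness is recorded separately as
  \<open>\<sim> \<zero> \<notin> I\<close>.\<close>

definition mv_ideal_set :: "('a, 'm) mv_struct_scheme \<Rightarrow> 'a set \<Rightarrow> bool" where
  "mv_ideal_set A I \<longleftrightarrow> I \<subseteq> carrier A \<and> \<zero>\<^bsub>A\<^esub> \<in> I \<and>
     (\<forall>x\<in>I. \<forall>y\<in>I. x \<oplus>\<^bsub>A\<^esub> y \<in> I) \<and>
     (\<forall>y\<in>I. \<forall>x\<in>carrier A. mv_le A x y \<longrightarrow> x \<in> I)"

lemma mv_ideal_setD:
  assumes "mv_ideal_set A I"
  shows "x \<in> I \<Longrightarrow> x \<in> carrier A" "\<zero>\<^bsub>A\<^esub> \<in> I" "\<lbrakk>x \<in> I; y \<in> I\<rbrakk> \<Longrightarrow> x \<oplus>\<^bsub>A\<^esub> y \<in> I"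
    "\<lbrakk>y \<in> I; x \<in> carrier A; mv_le A x y\<rbrakk> \<Longrightarrow> x \<in> I"
  using assms unfolding mv_ideal_set_def by blast+

lemma mv_homD:
  assumes "h \<in> mv_hom A B"
  shows "x \<in> carrier A \<Longrightarrow> h x \<in> carrier B" "h \<zero>\<^bsub>A\<^esub> = \<zero>\<^bsub>B\<^esub>"
    "\<lbrakk>x \<in> carrier A; y \<in> carrier A\<rbrakk> \<Longrightarrow> h (x \<oplus>\<^bsub>A\<^esub> y) = h x \<oplus>\<^bsub>B\<^esub> h y"
    "x \<in> carrier A \<Longrightarrow> h (\<sim>\<^bsub>A\<^esub> x) = \<sim>\<^bsub>B\<^esub> h x"
  using assms by (auto simp: mv_hom_def)

lemma mv_hom_le:
  assumes "mv_algebra A" "h \<in> mv_hom A B" "x \<in> carrier A" "y \<in> carrier A" "mv_le A x y"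
  shows "mv_le B (h x) (h y)"
proof -
  interpret mv_algebra A by fact
  show ?thesis using assms(2-5) unfolding mv_le_def
    by (metis mv_homD zero_closed neg_closed)
qed

text \<open>Homomorphisms are monotone and zero is least in the codomain, so kernels are
  down-closed; nontriviality of the codomain keeps the top out.\<close>

lemma mv_ideal_imp_set:
  assumes "mv_algebra A" "mv_ideal A I"
  shows "mv_ideal_set A I" "\<sim>\<^bsub>A\<^esub> \<zero>\<^bsub>A\<^esub> \<notin> I"
proof -
  interpret A: mv_algebra A by fact
  from assms(2) obtain B :: "'a set mv_struct" and h where
    B: "mv_algebra B" and h: "h \<in> mv_hom A B" and I: "I = mv_kernel A B h"
    unfolding mv_ideal_def by blast
  interpret B: mv_algebra B by fact
  note hD = mv_homD[OF h]
  have "x \<in> I" if "y \<in> I" "x \<in> carrier A" "mv_le A x y" for x y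
    using mv_hom_le[OF assms(1) h, of x y] that B.le_antisym[of "h x" "\<zero>\<^bsub>B\<^esub>"]
    by (auto simp: I mv_kernel_def hD)
  then show "mv_ideal_set A I"
    unfolding mv_ideal_set_def by (auto simp: I mv_kernel_def hD B.zero_plus)
  show "\<sim>\<^bsub>A\<^esub> \<zero>\<^bsub>A\<^esub> \<notin> I"
    using B.neg_zero_neq_zero by (simp add: I mv_kernel_def hD)
qed

locale mv_proper_ideal = mv_algebra +
  fixes I
  assumes ideal: "mv_ideal_set A I"
    and proper: "\<sim> \<zero> \<notin> I"
begin

definition cls where "cls x = mv_cong A I `` {x}"

lemma dist_mem_iff:
  assumes "x \<in> carrier A" "y \<in> carrier A"
  shows "mv_dist A x y \<in> I \<longleftrightarrow> x \<ominus> y \<in> I \<and> y \<ominus> x \<in> I"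
  using assms le_plus[of "x \<ominus> y" "y \<ominus> x"] le_plus[of "y \<ominus> x" "x \<ominus> y"] mv_ideal_setD[OF ideal]
  unfolding mv_dist_def by (meson neg_closed plus_closed)

lemma mv_cong_iff:
  "(x, y) \<in> mv_cong A I \<longleftrightarrow>
    x \<in> carrier A \<and> y \<in> carrier A \<and> x \<ominus> y \<in> I \<and> y \<ominus> x \<in> I"
  unfolding mv_cong_def using dist_mem_iff by auto

lemma minus_mem_trans:
  assumes "x \<in> carrier A" "y \<in> carrier A" "z \<in> carrier A" "x \<ominus> y \<in> I" "y \<ominus> z \<in> I"
  shows "x \<ominus> z \<in> I"
  using minus_triangle[of x y z] mv_ideal_setD(3,4)[OF ideal] assms by (meson neg_closed plus_closed)

lemma plus_minus_plus_mem:
  assumes "x \<in> carrier A" "y \<in> carrier A" "u \<in> carrier A" "v \<in> carrier A"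
    and "x \<ominus> y \<in> I" "u \<ominus> v \<in> I"
  shows "(x \<oplus> u) \<ominus> (y \<oplus> v) \<in> I"
  using plus_minus_plus_le[of x y u v] mv_ideal_setD(3,4)[OF ideal] assms
  by (meson neg_closed plus_closed)

lemma equiv: "equiv (carrier A) (mv_cong A I)"
proof (rule equivI)
  show "mv_cong A I \<subseteq> carrier A \<times> carrier A" by (auto simp: mv_cong_def)
  show "refl_on (carrier A) (mv_cong A I)"
    by (auto simp: refl_on_def mv_cong_iff neg_plus neg_neg mv_ideal_setD(2)[OF ideal])
  show "sym (mv_cong A I)" by (auto simp: sym_def mv_cong_iff)
  show "trans (mv_cong A I)"
    unfolding trans_def mv_cong_iff using minus_mem_trans by blast
qed

lemma cls_eq_iff:
  assumes "x \<in> carrier A" "y \<in> carrier A"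
  shows "cls x = cls y \<longleftrightarrow> x \<ominus> y \<in> I \<and> y \<ominus> x \<in> I"
  using eq_equiv_class_iff[OF equiv assms] assms by (simp add: mv_cong_iff cls_def)

lemma quot_carrier: "carrier (mv_quot A I) = cls ` carrier A"
  by (auto simp: mv_quot_def quotient_def cls_def)

lemma quot_zero: "\<zero>\<^bsub>mv_quot A I\<^esub> = cls \<zero>"
  by (simp add: mv_quot_def cls_def)

text \<open>The quotient operation is a union over representatives, which the congruence collapses
  to a single class; for negation the two differences merely trade places.\<close>

lemma quot_neg:
  assumes "x \<in> carrier A"
  shows "\<sim>\<^bsub>mv_quot A I\<^esub> cls x = cls (\<sim> x)"
proof -
  have "congruent (mv_cong A I) (\<lambda>x. cls (\<sim> x))"
    by (auto simp: congruent_def mv_cong_iff cls_eq_iff neg_minus_neg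
        del: subset_antisym)
  from UN_equiv_class[OF equiv this assms] show ?thesis
    by (simp add: mv_quot_def cls_def)
qed

lemma quot_plus:
  assumes "x \<in> carrier A" "y \<in> carrier A"
  shows "cls x \<oplus>\<^bsub>mv_quot A I\<^esub> cls y = cls (x \<oplus> y)"
proof -
  have "congruent2 (mv_cong A I) (mv_cong A I) (\<lambda>x y. cls (x \<oplus> y))"
    by (auto simp: congruent2_def mv_cong_iff cls_eq_iff plus_minus_plus_mem
        del: subset_antisym)
  from UN_equiv_class2[OF equiv equiv this assms] show ?thesis
    by (simp add: mv_quot_def cls_def)
qed

lemma cls_hom: "cls \<in> mv_hom A (mv_quot A I)"
  by (auto simp: mv_hom_def quot_carrier quot_zero quot_neg quot_plus)

lemma cls_eq_zero_iff:
  assumes "x \<in> carrier A"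
  shows "cls x = cls \<zero> \<longleftrightarrow> x \<in> I"
  using assms mv_ideal_setD(2)[OF ideal] by (simp add: cls_eq_iff minus_zero zero_minus)

lemma quot_mv_algebra: "mv_algebra (mv_quot A I)"
proof (rule mv_algebraI)
  show "\<sim>\<^bsub>mv_quot A I\<^esub> \<zero>\<^bsub>mv_quot A I\<^esub> \<noteq> \<zero>\<^bsub>mv_quot A I\<^esub>"
    using proper by (simp add: quot_zero quot_neg cls_eq_zero_iff)
qed (auto simp: quot_carrier quot_zero quot_plus quot_neg plus_assoc zero_plus neg_neg plus_neg_zero
    intro!: arg_cong[where f = cls] plus_comm mv_axiom
    del: subset_antisym)

text \<open>Converse of \<open>mv_ideal_imp_set\<close>: \<open>I\<close> is the kernel of its own
  quotient map, whose codomain has elements of type \<open>'a set\<close>, as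
  \<open>mv_ideal\<close> requires.\<close>

lemma mv_ideal: "mv_ideal A I"
proof -
  have "I = mv_kernel A (mv_quot A I) cls"
    using mv_ideal_setD(1)[OF ideal]
    by (simp add: mv_kernel_def quot_zero cls_eq_zero_iff cong: conj_cong) blast
  then show ?thesis
    unfolding mv_ideal_def using quot_mv_algebra cls_hom by blast
qed

text \<open>The class of \<open>x\<close> lies below that of \<open>y\<close> when
  \<open>\<sim> x \<oplus> y\<close> is congruent to the top, and the distance of that element from
  the top is \<open>x \<ominus> y\<close>.\<close>

lemma quot_totally_ordered_iff:
  "mv_totally_ordered (mv_quot A I) \<longleftrightarrow>
    (\<forall>x\<in>carrier A. \<forall>y\<in>carrier A. x \<ominus> y \<in> I \<or> y \<ominus> x \<in> I)"
proof -
  have "mv_le (mv_quot A I) (cls x) (cls y) \<longleftrightarrow> x \<ominus> y \<in> I"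
    if "x \<in> carrier A" "y \<in> carrier A" for x y
    using that mv_ideal_setD(2)[OF ideal]
    by (simp add: mv_le_def quot_neg quot_plus quot_zero cls_eq_iff plus_neg_zero neg_neg zero_plus)
  then show ?thesis
    by (simp add: mv_totally_ordered_def quot_carrier)
qed

end

section \<open>Prime ideals and separation of nonzero elements from zero\<close>

lemma (in mv_algebra) mv_prime_ideal_iff:
  "mv_prime_ideal A P \<longleftrightarrow> mv_ideal_set A P \<and> \<sim> \<zero> \<notin> P \<and>
    (\<forall>x\<in>carrier A. \<forall>y\<in>carrier A. x \<ominus> y \<in> P \<or> y \<ominus> x \<in> P)"
proof (cases "mv_ideal_set A P \<and> \<sim> \<zero> \<notin> P")
  case True
  then interpret mv_proper_ideal A P by unfold_locales auto
  show ?thesis using True mv_ideal quot_totally_ordered_iff by (auto simp: mv_prime_ideal_def)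
next
  case False
  then show ?thesis
    using mv_ideal_imp_set[OF mv_algebra_axioms] unfolding mv_prime_ideal_def by blast
qed

text \<open>\<open>Q\<close> is the ideal generated by \<open>P\<close> and \<open>u\<close>,
  possibly improper. A sum is bounded by collecting the parts from \<open>P\<close> and the copies
  of \<open>u\<close> separately.\<close>

lemma (in mv_algebra) adjoin_ideal_set:
  assumes P: "mv_ideal_set A P" and u: "u \<in> carrier A"
  defines "Q \<equiv> {z \<in> carrier A. \<exists>p\<in>P. \<exists>n. z \<preceq> p \<oplus> times n u}"
  shows "mv_ideal_set A Q" "P \<subseteq> Q" "u \<in> Q"
proof -
  note PD = mv_ideal_setD[OF P]
  show "P \<subseteq> Q"
  proof
    fix z assume "z \<in> P"
    then show "z \<in> Q" using PD(1) unfolding Q_def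
      by (auto intro!: bexI[of _ z] exI[of _ 0] simp: plus_zero)
  qed
  show "u \<in> Q"
    using PD(2) u unfolding Q_def
    by (auto intro!: bexI[of _ \<zero>] exI[of _ "Suc 0"] simp: plus_zero zero_plus)
  have "x \<oplus> y \<in> Q" if xy: "x \<in> Q" "y \<in> Q" for x y
  proof -
    obtain p m where p: "p \<in> P" "x \<preceq> p \<oplus> times m u" and x: "x \<in> carrier A"
      using xy unfolding Q_def by blast
    obtain q n where q: "q \<in> P" "y \<preceq> q \<oplus> times n u" and y: "y \<in> carrier A"
      using xy unfolding Q_def by blast
    have c: "p \<in> carrier A" "q \<in> carrier A" using p q PD(1) by auto
    have "x \<oplus> y \<preceq> (p \<oplus> times m u) \<oplus> (q \<oplus> times n u)"
      using p q x y c u by (intro plus_mono) auto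
    also have "(p \<oplus> times m u) \<oplus> (q \<oplus> times n u) = (p \<oplus> q) \<oplus> times (m + n) u"
      using c u by (simp add: times_add plus_assoc plus_left_comm[of "times m u" q])
    finally show ?thesis
      using PD(3)[of p q] p q x y unfolding Q_def by blast
  qed
  moreover have "x \<in> Q" if "y \<in> Q" "x \<in> carrier A" "x \<preceq> y" for x y
    using that le_trans[of x y] PD(1) u unfolding Q_def
    by (smt (verit, ccfv_threshold) mem_Collect_eq plus_closed times_closed)
  moreover have "\<zero> \<in> Q" using \<open>P \<subseteq> Q\<close> PD(2) by blast
  ultimately show "mv_ideal_set A Q"
    unfolding mv_ideal_set_def by (auto simp: Q_def)
qed

text \<open>Maximality means that adjoining any missing element captures \<open>a\<close>. Applied
  to both differences, this bounds \<open>a\<close> modulo \<open>P\<close> by multiples of two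
  disjoint elements, which forces \<open>a\<close> into \<open>P\<close>.\<close>

lemma (in mv_algebra) exists_prime_ideal_avoiding:
  assumes a: "a \<in> carrier A" "a \<noteq> \<zero>"
  shows "\<exists>P. mv_prime_ideal A P \<and> a \<notin> P"
proof -
  define F where "F = {I. mv_ideal_set A I \<and> a \<notin> I}"
  have "mv_ideal_set A {\<zero>}"
    using le_antisym[of _ \<zero>] by (auto simp: mv_ideal_set_def zero_plus)
  then have "{\<zero>} \<in> F" using a by (simp add: F_def)
  moreover have "\<Union>C \<in> F" if C: "C \<noteq> {}" "subset.chain F C" for C
  proof -
    have CF: "C \<subseteq> F" and lin: "\<And>X Y. \<lbrakk>X \<in> C; Y \<in> C\<rbrakk> \<Longrightarrow> X \<subseteq> Y \<or> Y \<subseteq> X"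
      using C(2) by (auto simp: subset.chain_def)
    have "x \<oplus> y \<in> \<Union>C" if xy: "x \<in> \<Union>C" "y \<in> \<Union>C" for x y
    proof -
      obtain X Y where "X \<in> C" "x \<in> X" "Y \<in> C" "y \<in> Y" using xy by blast
      then obtain Z where "Z \<in> C" "x \<in> Z" "y \<in> Z" using lin by blast
      then have "x \<oplus> y \<in> Z" using CF mv_ideal_setD(3)[of A Z x y] by (auto simp: F_def)
      then show ?thesis using \<open>Z \<in> C\<close> by blast
    qed
    then show ?thesis
      using C(1) CF unfolding F_def mv_ideal_set_def by blast
  qed
  ultimately obtain P where P: "P \<in> F" and max: "\<And>X. \<lbrakk>X \<in> F; P \<subseteq> X\<rbrakk> \<Longrightarrow> X = P"
    using subset_Zorn_nonempty[of F] by blast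
  have id: "mv_ideal_set A P" and aP: "a \<notin> P" using P by (auto simp: F_def)
  note PD = mv_ideal_setD[OF id]
  have "x \<ominus> y \<in> P \<or> y \<ominus> x \<in> P" if xy: "x \<in> carrier A" "y \<in> carrier A" for x y
  proof (rule ccontr)
    assume neg: "\<not> ?thesis"
    have ex: "\<exists>p\<in>P. \<exists>n. a \<preceq> p \<oplus> times n u" if u: "u \<in> carrier A" "u \<notin> P" for u
    proof -
      let ?Q = "{z \<in> carrier A. \<exists>p\<in>P. \<exists>n. z \<preceq> p \<oplus> times n u}"
      have "?Q \<noteq> P" using adjoin_ideal_set(3)[OF id u(1)] u(2) by blast
      then have "?Q \<notin> F" using max adjoin_ideal_set(2)[OF id u(1)] by blast
      then have "a \<in> ?Q" using adjoin_ideal_set(1)[OF id u(1)] unfolding F_def by blast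
      then show ?thesis by blast
    qed
    obtain p m where p: "p \<in> P" "a \<preceq> p \<oplus> times m (x \<ominus> y)" using ex[of "x \<ominus> y"] neg xy by auto
    obtain q n where q: "q \<in> P" "a \<preceq> q \<oplus> times n (y \<ominus> x)" using ex[of "y \<ominus> x"] neg xy by auto
    have c: "p \<in> carrier A" "q \<in> carrier A" using p q PD(1) by auto
    \<comment> \<open>Enlarging \<open>p\<close> and \<open>q\<close> to the common
      \<open>p \<oplus> q\<close> puts one and the same element below both multiples, as
      \<open>times_disjoint\<close> needs.\<close>
    have "a \<ominus> (p \<oplus> q) \<preceq> z"
      if r: "r \<in> carrier A" "r \<preceq> p \<oplus> q" and z: "z \<in> carrier A" "a \<preceq> r \<oplus> z" for r z
    proof (rule le_trans[of _ "a \<ominus> r"])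
      show "a \<ominus> (p \<oplus> q) \<preceq> a \<ominus> r" using minus_antimono[of r "p \<oplus> q" a] r c a by simp
      show "a \<ominus> r \<preceq> z" using minus_le_iff[of a r z] r z a by simp
    qed (use r z c a in auto)
    from this[of p "times m (x \<ominus> y)"] this[of q "times n (y \<ominus> x)"]
    have "a \<ominus> (p \<oplus> q) \<preceq> times m (x \<ominus> y)" "a \<ominus> (p \<oplus> q) \<preceq> times n (y \<ominus> x)"
      using p(2) q(2) c xy le_plus(2)[of p q] le_plus(1)[of q p] by auto
    then have "a \<ominus> (p \<oplus> q) = \<zero>"
      using times_disjoint[of x y "a \<ominus> (p \<oplus> q)"] xy a c by simp
    then have "a \<preceq> p \<oplus> q" using minus_eq_zero_iff a c by simp
    then have "a \<in> P" using PD(3,4) p q a by blast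
    then show False using aP by simp
  qed
  moreover have "\<sim> \<zero> \<notin> P" using PD(4)[of "\<sim> \<zero>" a] aP a by auto
  ultimately show ?thesis using mv_prime_ideal_iff id aP by blast
qed

section \<open>Hopfian algebras: simple and finite spectrum\<close>

lemma (in mv_algebra) mv_hopfianI:
  assumes ker: "\<And>h a. \<lbrakk>h \<in> mv_hom A A; h ` carrier A = carrier A; a \<in> carrier A; h a = \<zero>\<rbrakk>
      \<Longrightarrow> a = \<zero>"
  shows "mv_hopfian A"
proof -
  have "h \<in> mv_hom A A \<and> inj_on h (carrier A) \<and> h ` carrier A = carrier A"
    if h: "h \<in> mv_hom A A" and surj: "h ` carrier A = carrier A" for h
  proof -
    note hD = mv_homD[OF h]
    have "inj_on h (carrier A)"
    proof
      fix x y assume xy: "x \<in> carrier A" "y \<in> carrier A" "h x = h y"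
      have "h (mv_dist A x y) = \<zero>"
        using xy by (simp add: mv_dist_def hD neg_plus neg_neg zero_plus)
      then have "mv_dist A x y = \<zero>"
        using ker[OF h surj] xy by (simp add: mv_dist_def)
      then show "x = y" using mv_dist_eq_zero xy by simp
    qed
    then show ?thesis using h surj by blast
  qed
  then show ?thesis unfolding mv_hopfian_def mv_aut_def bij_betw_def by blast
qed

lemma (in mv_algebra) mv_simple_hopfian:
  assumes "mv_simple A"
  shows "mv_hopfian A"
proof (rule mv_hopfianI)
  fix h a assume h: "h \<in> mv_hom A A" "a \<in> carrier A" "h a = \<zero>"
  then have "mv_kernel A A h = {\<zero>}"
    using mv_kernel_ideal[OF mv_algebra_axioms mv_algebra_axioms] \<open>mv_simple A\<close> by (auto simp: mv_simple_def)
  then show "a = \<zero>" using h by (auto simp: mv_kernel_def)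
qed

text \<open>
  Taking preimages under a surjective endomorphism is an injective self-map of the prime spectrum.
  If the spectrum is finite the map is surjective, so every prime contains the kernel.
\<close>
lemma (in mv_algebra) mv_finite_spectrum_hopfian:
  assumes fin: "finite {P. mv_prime_ideal A P}"
  shows "mv_hopfian A"
proof (rule mv_hopfianI)
  fix h a assume h: "h \<in> mv_hom A A" and surj: "h ` carrier A = carrier A"
    and a: "a \<in> carrier A" "h a = \<zero>"
  note hD = mv_homD[OF h]
  define \<phi> where "\<phi> P = {x \<in> carrier A. h x \<in> P}" for P
  have "\<phi> ` {P. mv_prime_ideal A P} \<subseteq> {P. mv_prime_ideal A P}"
  proof clarify
    fix P assume P: "mv_prime_ideal A P"
    then have id: "mv_ideal_set A P" by (simp add: mv_prime_ideal_iff)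
    have "x \<in> \<phi> P" if "y \<in> \<phi> P" "x \<in> carrier A" "x \<preceq> y" for x y
      using mv_hom_le[OF mv_algebra_axioms h, of x y] mv_ideal_setD(4)[OF id, of "h y" "h x"] that
      by (simp add: \<phi>_def hD)
    then have "mv_ideal_set A (\<phi> P)"
      unfolding mv_ideal_set_def using mv_ideal_setD(2,3)[OF id] by (simp add: \<phi>_def hD subset_iff)
    moreover have "\<sim> \<zero> \<notin> \<phi> P"
      using P by (simp add: mv_prime_ideal_iff \<phi>_def hD)
    moreover have "\<forall>x\<in>carrier A. \<forall>y\<in>carrier A. x \<ominus> y \<in> \<phi> P \<or> y \<ominus> x \<in> \<phi> P"
      using P by (simp add: mv_prime_ideal_iff \<phi>_def hD)
    ultimately show "mv_prime_ideal A (\<phi> P)" by (simp add: mv_prime_ideal_iff)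
  qed
  moreover have "inj_on \<phi> {P. mv_prime_ideal A P}"
  proof
    fix P Q assume P: "P \<in> {P. mv_prime_ideal A P}" and Q: "Q \<in> {P. mv_prime_ideal A P}"
      and eq: "\<phi> P = \<phi> Q"
    \<comment> \<open>Surjectivity lets the direct image undo the preimage, which gives
      injectivity.\<close>
    have "h ` \<phi> R = R" if "mv_prime_ideal A R" for R
    proof -
      have "R \<subseteq> carrier A" using that by (auto simp: mv_prime_ideal_iff mv_ideal_set_def)
      then show ?thesis using surj by (auto simp: \<phi>_def)
    qed
    then show "P = Q" using P Q eq by (metis mem_Collect_eq)
  qed
  ultimately have onto: "\<phi> ` {P. mv_prime_ideal A P} = {P. mv_prime_ideal A P}"
    using fin by (rule endo_inj_surj[rotated])
  show "a = \<zero>"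
  proof (rule ccontr)
    assume "a \<noteq> \<zero>"
    then obtain Q where Q: "mv_prime_ideal A Q" "a \<notin> Q"
      using exists_prime_ideal_avoiding a by blast
    then obtain P where "mv_prime_ideal A P" "Q = \<phi> P" using onto by blast
    then show False
      using Q a by (auto simp: \<phi>_def mv_prime_ideal_iff mv_ideal_set_def)
  qed
qed

section \<open>McNaughton functions\<close>

lemma int_affine_coord: "int_affine (\<lambda>x. x $ i)"
  unfolding int_affine_def
  by (intro exI[of _ "\<lambda>j. if j = i then 1 else 0"] exI[of _ 0])
    (simp add: if_distrib[where f = "\<lambda>u. u * _"] if_distrib[where f = of_int] cong: if_cong)

lemma int_affine_const: "int_affine (\<lambda>x. of_int b)"
  unfolding int_affine_def by (intro exI[of _ "\<lambda>j. 0"] exI[of _ b]) simp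

lemma int_affine_add:
  assumes "int_affine p" "int_affine q"
  shows "int_affine (\<lambda>x. p x + q x)"
proof -
  obtain a b where p: "\<forall>x. p x = (\<Sum>i\<in>UNIV. of_int (a i) * x $ i) + of_int b"
    using assms(1) unfolding int_affine_def by blast
  obtain c d where q: "\<forall>x. q x = (\<Sum>i\<in>UNIV. of_int (c i) * x $ i) + of_int d"
    using assms(2) unfolding int_affine_def by blast
  show ?thesis unfolding int_affine_def
    by (intro exI[of _ "\<lambda>i. a i + c i"] exI[of _ "b + d"])
      (simp add: p q distrib_right sum.distrib)
qed

lemma int_affine_cmult:
  assumes "int_affine p"
  shows "int_affine (\<lambda>x. of_int m * p x)"
proof -
  obtain a b where p: "\<forall>x. p x = (\<Sum>i\<in>UNIV. of_int (a i) * x $ i) + of_int b"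
    using assms(1) unfolding int_affine_def by blast
  show ?thesis unfolding int_affine_def
    by (intro exI[of _ "\<lambda>i. m * a i"] exI[of _ "m * b"])
      (simp add: p distrib_left sum_distrib_left mult.assoc)
qed

lemma int_affine_one_minus:
  assumes "int_affine p"
  shows "int_affine (\<lambda>x. 1 - p x)"
  using int_affine_add[OF int_affine_const[of 1] int_affine_cmult[OF assms, of "-1"]] by simp

lemma int_affine_continuous:
  assumes "int_affine p"
  shows "continuous_on S p"
proof -
  obtain a b where p: "p = (\<lambda>x. (\<Sum>i\<in>UNIV. of_int (a i) * x $ i) + of_int b)"
    using assms unfolding int_affine_def by blast
  show ?thesis unfolding p by (intro continuous_intros)
qed

text \<open>Reduces the key inequality of McNaughton's theorem to one real variable.\<close>

lemma int_affine_segment: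
  assumes "int_affine p"
  shows "p (x + t *\<^sub>R (y - x)) = p x + t * (p y - p x)"
proof -
  obtain a b where p: "p = (\<lambda>x. (\<Sum>i\<in>UNIV. of_int (a i) * x $ i) + of_int b)"
    using assms unfolding int_affine_def by blast
  have "(\<Sum>i\<in>UNIV. of_int (a i) * (x + t *\<^sub>R (y - x)) $ i)
      = (\<Sum>i\<in>UNIV. of_int (a i) * x $ i + t * (of_int (a i) * y $ i - of_int (a i) * x $ i))"
    by (intro sum.cong refl) (simp add: algebra_simps)
  then show ?thesis
    unfolding p by (simp add: sum.distrib sum_subtractf flip: sum_distrib_left)
qed

text \<open>Some coordinate differs; a rational a/b strictly between the two values yields the
  function b z_i - a, with a change of sign if the order is reversed. The points may be irrational,
  only the cut is rational.\<close>

lemma separating_int_affine: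
  fixes x y :: "real ^ 'n"
  assumes "x \<noteq> y"
  obtains p :: "real ^ 'n \<Rightarrow> real" where "int_affine p" "p x < 0" "0 < p y"
proof -
  have sep: "\<exists>p. int_affine p \<and> p x < 0 \<and> 0 < p y" if lt: "x $ i < y $ i" for x y :: "real ^ 'n" and i
  proof -
    obtain q where q: "x $ i < of_rat q" "of_rat q < y $ i" using of_rat_dense[OF lt] by blast
    obtain a b where ab: "quotient_of q = (a, b)" by fastforce
    then have b: "b > 0" using quotient_of_denom_pos by blast
    have q': "of_rat q = real_of_int a / real_of_int b"
      using quotient_of_div[OF ab] by (simp add: of_rat_divide)
    have "int_affine (\<lambda>z. of_int b * z $ i + of_int (- a))"
      by (rule int_affine_add[OF int_affine_cmult[OF int_affine_coord] int_affine_const])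
    then show ?thesis
      using q b unfolding q'
      by (intro exI[of _ "\<lambda>z. of_int b * z $ i + of_int (- a)"]) (simp add: field_simps)
  qed
  obtain i where "x $ i \<noteq> y $ i" using assms by (auto simp: vec_eq_iff)
  then consider "x $ i < y $ i" | "y $ i < x $ i" by linarith
  then show thesis
  proof cases
    case 1
    then show ?thesis using sep that by blast
  next
    case 2
    then obtain p where p: "int_affine p" "p y < 0" "0 < p x" using sep by blast
    then show ?thesis
      using that[of "\<lambda>x. of_int (- 1) * p x"] int_affine_cmult[OF p(1), of "- 1"] by simp
  qed
qed

definition mcn_clamp :: "(real ^ 'n \<Rightarrow> real) \<Rightarrow> real ^ 'n \<Rightarrow> real" where
  "mcn_clamp p = (\<lambda>x\<in>unit_cube. max 0 (min 1 (p x)))"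

definition coord :: "'n \<Rightarrow> real ^ 'n \<Rightarrow> real" where
  "coord i = (\<lambda>x\<in>unit_cube. x $ i)"

lemma mcnaughton_functionsI:
  assumes "f \<in> extensional unit_cube" "\<And>x. x \<in> unit_cube \<Longrightarrow> 0 \<le> f x \<and> f x \<le> 1"
    and "continuous_on unit_cube f" "finite P" "\<And>p. p \<in> P \<Longrightarrow> int_affine p"
    and "\<And>x. x \<in> unit_cube \<Longrightarrow> \<exists>p\<in>P. f x = p x"
  shows "f \<in> mcnaughton_functions"
  using assms unfolding mcnaughton_functions_def by (auto simp: PiE_iff)

lemma mcnaughton_functionsD:
  assumes "f \<in> mcnaughton_functions"
  shows "f \<in> extensional unit_cube" "x \<in> unit_cube \<Longrightarrow> 0 \<le> f x" "x \<in> unit_cube \<Longrightarrow> f x \<le> 1"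
    "continuous_on unit_cube f"
  using assms unfolding mcnaughton_functions_def by (auto simp: PiE_iff)

lemma mcnaughton_pieces:
  assumes "f \<in> mcnaughton_functions"
  obtains P where "finite P" "\<And>p. p \<in> P \<Longrightarrow> int_affine p"
    "\<And>x. x \<in> unit_cube \<Longrightarrow> \<exists>p\<in>P. f x = p x"
  using assms unfolding mcnaughton_functions_def by blast

lemma continuous_on_restrict:
  "continuous_on S (restrict f S) \<longleftrightarrow> continuous_on S f"
  by (rule continuous_on_cong) auto

lemma mcnaughton_zero: "(\<lambda>x\<in>unit_cube. 0) \<in> mcnaughton_functions"
  using int_affine_const[of 0]
  by (intro mcnaughton_functionsI[where P = "{\<lambda>x. 0}"]) (auto simp: continuous_on_restrict)

lemma mcnaughton_neg:
  assumes "f \<in> mcnaughton_functions"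
  shows "(\<lambda>x\<in>unit_cube. 1 - f x) \<in> mcnaughton_functions"
proof -
  note fD = mcnaughton_functionsD[OF assms]
  obtain P where P: "finite P" "\<And>p. p \<in> P \<Longrightarrow> int_affine p"
    "\<And>x. x \<in> unit_cube \<Longrightarrow> \<exists>p\<in>P. f x = p x"
    using mcnaughton_pieces[OF assms] by blast
  show ?thesis
  proof (rule mcnaughton_functionsI[where P = "(\<lambda>p x. 1 - p x) ` P"])
    show "continuous_on unit_cube (\<lambda>x\<in>unit_cube. 1 - f x)"
      unfolding continuous_on_restrict by (intro continuous_intros fD)
    show "\<exists>p\<in>(\<lambda>p x. 1 - p x) ` P. (\<lambda>x\<in>unit_cube. 1 - f x) x = p x" if "x \<in> unit_cube" for x
      using P(3)[OF that] that by auto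
    show "int_affine q" if "q \<in> (\<lambda>p x. 1 - p x) ` P" for q
      using that P(2) int_affine_one_minus by blast
  qed (use P(1) fD in auto)
qed

lemma mcnaughton_plus:
  assumes f: "f \<in> mcnaughton_functions" and g: "g \<in> mcnaughton_functions"
  shows "(\<lambda>x\<in>unit_cube. min 1 (f x + g x)) \<in> mcnaughton_functions"
proof -
  note fD = mcnaughton_functionsD[OF f] and gD = mcnaughton_functionsD[OF g]
  obtain P where P: "finite P" "\<And>p. p \<in> P \<Longrightarrow> int_affine p"
    "\<And>x. x \<in> unit_cube \<Longrightarrow> \<exists>p\<in>P. f x = p x"
    using mcnaughton_pieces[OF f] by blast
  obtain Q where Q: "finite Q" "\<And>p. p \<in> Q \<Longrightarrow> int_affine p"
    "\<And>x. x \<in> unit_cube \<Longrightarrow> \<exists>p\<in>Q. g x = p x"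
    using mcnaughton_pieces[OF g] by blast
  \<comment> \<open>Sums of pieces represent the untruncated sum; the constant 1 covers the points
    where truncation acts.\<close>
  define R where "R = insert (\<lambda>x. 1) ((\<lambda>(p, q) x. p x + q x) ` (P \<times> Q))"
  show ?thesis
  proof (rule mcnaughton_functionsI[where P = R])
    show "continuous_on unit_cube (\<lambda>x\<in>unit_cube. min 1 (f x + g x))"
      unfolding continuous_on_restrict by (intro continuous_intros fD gD)
    show "finite R" using P Q by (simp add: R_def)
    show "int_affine r" if "r \<in> R" for r
      using that P(2) Q(2) int_affine_add int_affine_const[of 1] by (auto simp: R_def)
    fix x :: "real ^ 'a" assume x: "x \<in> unit_cube"
    obtain p q where pq: "p \<in> P" "f x = p x" "q \<in> Q" "g x = q x" using P(3) Q(3) x by blast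
    then have "(\<lambda>x. p x + q x) \<in> R" "(\<lambda>x. 1) \<in> R" by (force simp: R_def)+
    then show "\<exists>r\<in>R. (\<lambda>x\<in>unit_cube. min 1 (f x + g x)) x = r x"
      using x pq by (auto simp: min_def intro: bexI[of _ "\<lambda>x. p x + q x"] bexI[of _ "\<lambda>x. 1"])
    show "0 \<le> (\<lambda>x\<in>unit_cube. min 1 (f x + g x)) x \<and> (\<lambda>x\<in>unit_cube. min 1 (f x + g x)) x \<le> 1"
      using x fD(2) gD(2) by simp
  qed auto
qed

lemma clamp_mcnaughton:
  assumes "int_affine p"
  shows "mcn_clamp p \<in> mcnaughton_functions"
proof (rule mcnaughton_functionsI[where P = "{\<lambda>x. 0, \<lambda>x. 1, p}"])
  show "continuous_on unit_cube (mcn_clamp p)"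
    unfolding mcn_clamp_def continuous_on_restrict
    by (intro continuous_intros int_affine_continuous assms)
qed (use assms int_affine_const[of 0] int_affine_const[of 1] in \<open>auto simp: mcn_clamp_def min_def max_def\<close>)

lemma coord_eq_clamp: "coord i = mcn_clamp (\<lambda>x. x $ i)"
  by (auto simp: coord_def mcn_clamp_def unit_cube_def fun_eq_iff restrict_def)

lemma mcnaughton_simps:
  "carrier mcnaughton = mcnaughton_functions"
  "\<zero>\<^bsub>mcnaughton\<^esub> = (\<lambda>x\<in>unit_cube. 0)"
  "f \<oplus>\<^bsub>mcnaughton\<^esub> g = (\<lambda>x\<in>unit_cube. min 1 (f x + g x))"
  "\<sim>\<^bsub>mcnaughton\<^esub> f = (\<lambda>x\<in>unit_cube. 1 - f x)"
  by (simp_all add: mcnaughton_def)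

lemma zero_in_unit_cube: "0 \<in> unit_cube"
  by (simp add: unit_cube_def)

lemma mv_algebra_mcnaughton: "mv_algebra (mcnaughton :: (real ^ 'n \<Rightarrow> real) mv_struct)"
proof (rule mv_algebraI)
  show "\<sim>\<^bsub>mcnaughton\<^esub> \<zero>\<^bsub>mcnaughton\<^esub> \<noteq> (\<zero>\<^bsub>mcnaughton\<^esub> :: real ^ 'n \<Rightarrow> real)"
    unfolding mcnaughton_simps
    by (rule notI, drule fun_cong[where x = 0]) (simp add: zero_in_unit_cube)
next
  fix f g k :: "real ^ 'n \<Rightarrow> real"
  assume "f \<in> carrier mcnaughton" "g \<in> carrier mcnaughton" "k \<in> carrier mcnaughton"
  then have "0 \<le> f x" "0 \<le> g x" "0 \<le> k x" if "x \<in> unit_cube" for x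
    using that mcnaughton_functionsD by (auto simp: mcnaughton_simps)
  then show "f \<oplus>\<^bsub>mcnaughton\<^esub> g \<oplus>\<^bsub>mcnaughton\<^esub> k = f \<oplus>\<^bsub>mcnaughton\<^esub> (g \<oplus>\<^bsub>mcnaughton\<^esub> k)"
    unfolding mcnaughton_simps by (intro restrict_ext) (fastforce simp: min_def)
next
  fix f g :: "real ^ 'n \<Rightarrow> real"
  assume "f \<in> carrier mcnaughton" "g \<in> carrier mcnaughton"
  then have *: "0 \<le> f x \<and> 0 \<le> g x \<and> f x \<le> 1 \<and> g x \<le> 1" if "x \<in> unit_cube" for x
    using that mcnaughton_functionsD by (auto simp: mcnaughton_simps)
  show "\<sim>\<^bsub>mcnaughton\<^esub> (\<sim>\<^bsub>mcnaughton\<^esub> f \<oplus>\<^bsub>mcnaughton\<^esub> g) \<oplus>\<^bsub>mcnaughton\<^esub> g =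
      \<sim>\<^bsub>mcnaughton\<^esub> (\<sim>\<^bsub>mcnaughton\<^esub> g \<oplus>\<^bsub>mcnaughton\<^esub> f) \<oplus>\<^bsub>mcnaughton\<^esub> f"
    unfolding mcnaughton_simps by (intro restrict_ext) (use * in \<open>simp add: min_def\<close>)
  show "f \<oplus>\<^bsub>mcnaughton\<^esub> g = g \<oplus>\<^bsub>mcnaughton\<^esub> f"
    by (simp add: mcnaughton_simps add.commute)
next
  fix f :: "real ^ 'n \<Rightarrow> real"
  assume f: "f \<in> carrier mcnaughton"
  \<comment> \<open>Members are extensional, so each is its own restriction and the identities need
    only be checked on the cube.\<close>
  then have ext: "f = restrict f unit_cube"
    using mcnaughton_functionsD(1) extensional_restrict by (metis mcnaughton_simps(1))
  have *: "0 \<le> f x \<and> f x \<le> 1" if "x \<in> unit_cube" for x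
    using that f mcnaughton_functionsD by (auto simp: mcnaughton_simps)
  show "\<zero>\<^bsub>mcnaughton\<^esub> \<oplus>\<^bsub>mcnaughton\<^esub> f = f"
    by (subst (2) ext) (auto simp: mcnaughton_simps * intro!: restrict_ext)
  show "\<sim>\<^bsub>mcnaughton\<^esub> (\<sim>\<^bsub>mcnaughton\<^esub> f) = f"
    by (subst (2) ext) (auto simp: mcnaughton_simps intro!: restrict_ext)
  show "f \<oplus>\<^bsub>mcnaughton\<^esub> \<sim>\<^bsub>mcnaughton\<^esub> \<zero>\<^bsub>mcnaughton\<^esub> = \<sim>\<^bsub>mcnaughton\<^esub> \<zero>\<^bsub>mcnaughton\<^esub>"
    using * by (auto simp: mcnaughton_simps intro!: restrict_ext)
qed (simp_all add: mcnaughton_simps mcnaughton_zero mcnaughton_plus mcnaughton_neg)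

section \<open>McNaughton's theorem\<close>

abbreviation mcn_gen :: "(real ^ 'n \<Rightarrow> real) set" where
  "mcn_gen \<equiv> mv_generate mcnaughton (range coord)"

lemma mcn_gen_subset: "mcn_gen \<subseteq> mcnaughton_functions"
proof
  fix f :: "real ^ 'n \<Rightarrow> real" assume "f \<in> mcn_gen"
  then show "f \<in> mcnaughton_functions"
  proof (induction rule: mv_generate.induct)
    case (incl f)
    then show ?case using clamp_mcnaughton[OF int_affine_coord] by (auto simp: coord_eq_clamp)
  qed (simp_all only: mcnaughton_simps mcnaughton_zero mcnaughton_plus mcnaughton_neg)
qed

lemma mcn_gen_bounds:
  assumes "f \<in> mcn_gen" "x \<in> unit_cube"
  shows "0 \<le> f x" "f x \<le> 1"
  using mcnaughton_functionsD(2,3) mcn_gen_subset assms by blast+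

lemma mcn_gen_congI:
  assumes "f \<in> mcn_gen" "\<And>x. x \<in> unit_cube \<Longrightarrow> f x = g x"
  shows "restrict g unit_cube \<in> mcn_gen"
proof -
  have "f \<in> extensional unit_cube" using mcnaughton_functionsD(1) mcn_gen_subset assms(1) by blast
  then have "f = restrict g unit_cube"
    using assms(2) by (auto simp: fun_eq_iff restrict_def extensional_def)
  then show ?thesis using assms(1) by simp
qed

text \<open>The abstract join term, difference plus subtrahend, evaluates pointwise to the
  maximum.\<close>

lemma mcn_gen_max:
  assumes f: "f \<in> mcn_gen" and g: "g \<in> mcn_gen"
  shows "(\<lambda>x\<in>unit_cube. max (f x) (g x)) \<in> mcn_gen"
proof (rule mcn_gen_congI)
  let ?m = "\<sim>\<^bsub>mcnaughton\<^esub> (\<sim>\<^bsub>mcnaughton\<^esub> f \<oplus>\<^bsub>mcnaughton\<^esub> g) \<oplus>\<^bsub>mcnaughton\<^esub> g"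
  show "?m \<in> mcn_gen" using f g by (intro mv_generate.plus mv_generate.neg)
  show "?m x = max (f x) (g x)" if "x \<in> unit_cube" for x
    using that mcn_gen_bounds[OF f that] mcn_gen_bounds[OF g that]
    by (simp add: mcnaughton_simps min_def max_def)
qed

lemma mcn_gen_min:
  assumes f: "f \<in> mcn_gen" and g: "g \<in> mcn_gen"
  shows "(\<lambda>x\<in>unit_cube. min (f x) (g x)) \<in> mcn_gen"
proof (rule mcn_gen_congI)
  let ?N = "mv_neg mcnaughton"
  let ?m = "?N (\<lambda>x\<in>unit_cube. max (?N f x) (?N g x))"
  show "?m \<in> mcn_gen" using f g by (intro mv_generate.neg mcn_gen_max)
  show "?m x = min (f x) (g x)" if "x \<in> unit_cube" for x
    using that by (simp add: mcnaughton_simps min_def max_def)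
qed

lemma mcn_gen_Max:
  assumes "finite I" "I \<noteq> {}" "\<And>i. i \<in> I \<Longrightarrow> \<phi> i \<in> mcn_gen"
  shows "(\<lambda>x\<in>unit_cube. Max ((\<lambda>i. \<phi> i x) ` I)) \<in> mcn_gen"
  using assms
proof (induction I rule: finite_ne_induct)
  case (singleton i)
  then have "\<phi> i \<in> mcn_gen" by simp
  then show ?case by (rule mcn_gen_congI) simp
next
  case (insert i I)
  then have "(\<lambda>x\<in>unit_cube. max (\<phi> i x) ((\<lambda>x\<in>unit_cube. Max ((\<lambda>i. \<phi> i x) ` I)) x)) \<in> mcn_gen"
    by (intro mcn_gen_max) auto
  then show ?case by (rule mcn_gen_congI) (use insert in simp)
qed

lemma mcn_gen_Min:
  assumes "finite I" "I \<noteq> {}" "\<And>i. i \<in> I \<Longrightarrow> \<phi> i \<in> mcn_gen"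
  shows "(\<lambda>x\<in>unit_cube. Min ((\<lambda>i. \<phi> i x) ` I)) \<in> mcn_gen"
  using assms
proof (induction I rule: finite_ne_induct)
  case (singleton i)
  then have "\<phi> i \<in> mcn_gen" by simp
  then show ?case by (rule mcn_gen_congI) simp
next
  case (insert i I)
  then have "(\<lambda>x\<in>unit_cube. min (\<phi> i x) ((\<lambda>x\<in>unit_cube. Min ((\<lambda>i. \<phi> i x) ` I)) x)) \<in> mcn_gen"
    by (intro mcn_gen_min) auto
  then show ?case by (rule mcn_gen_congI) (use insert in simp)
qed

text \<open>
  Induction on the sum of the absolute values of the coefficients. If the coefficient of \<open>x\<^sub>i\<close>
  is positive write \<open>p = h + x\<^sub>i\<close> and use \<open>p\<^sup># = (h\<^sup># \<oplus> x\<^sub>i) \<odot> (h + 1)\<^sup>#\<close>, where \<open>\<^sup>#\<close> is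
  truncation to the unit interval; a negative coefficient reduces to this by \<open>p\<^sup># = \<not> (1 - p)\<^sup>#\<close>.
\<close>
lemma clamp_in_mcn_gen:
  fixes p :: "real ^ 'n \<Rightarrow> real"
  assumes "int_affine p"
  shows "mcn_clamp p \<in> mcn_gen"
proof -
  define L :: "('n \<Rightarrow> int) \<Rightarrow> int \<Rightarrow> real ^ 'n \<Rightarrow> real"
    where "L a b x = (\<Sum>i\<in>UNIV. of_int (a i) * x $ i) + of_int b" for a b x
  define N :: "('n \<Rightarrow> int) \<Rightarrow> nat" where "N a = (\<Sum>i\<in>UNIV. nat \<bar>a i\<bar>)" for a
  have "mcn_clamp (L a b) \<in> mcn_gen" for a b
  proof (induction "N a" arbitrary: a b rule: less_induct)
    case less
    \<comment> \<open>Stated for every coefficient vector of the current weight, so that it also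
      serves for the negated vector, which has the same weight.\<close>
    have pos: "mcn_clamp (L c d) \<in> mcn_gen" if c: "c i > 0" "N c = N a" for c d i
    proof -
      define c' where "c' j = c j - (if j = i then 1 else 0)" for j
      have "N c' < N c" unfolding N_def
        by (rule sum_strict_mono_ex1) (use c in \<open>auto simp: c'_def\<close>)
      then have IH: "mcn_clamp (L c' e) \<in> mcn_gen" for e using less c by simp
      have L: "L c d x = L c' d x + x $ i" "L c' (d + 1) x = L c' d x + 1" for x
        by (simp_all add: L_def c'_def left_diff_distrib sum_subtractf
            if_distrib[where f = "\<lambda>u. u * _"] if_distrib[where f = of_int] cong: if_cong)
      let ?N = "mv_neg mcnaughton"
      \<comment> \<open>The product \<open>u \<odot> v\<close> spelled out as
        \<open>\<sim> (\<sim> u \<oplus> \<sim> v)\<close>. Both truncations have coefficients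
        \<open>c'\<close>; the weight ignores the constant term, so \<open>d + 1\<close> is
        harmless.\<close>
      let ?m = "?N (?N (mcn_clamp (L c' d) \<oplus>\<^bsub>mcnaughton\<^esub> coord i)
        \<oplus>\<^bsub>mcnaughton\<^esub> ?N (mcn_clamp (L c' (d + 1))))"
      show ?thesis unfolding mcn_clamp_def
      proof (rule mcn_gen_congI)
        show "?m \<in> mcn_gen" using IH by (intro mv_generate.plus mv_generate.neg mv_generate.incl[of "coord i"])
            auto
        show "?m x = max 0 (min 1 (L c d x))" if x: "x \<in> unit_cube" for x
        proof -
          have "0 \<le> x $ i" "x $ i \<le> 1" using x by (auto simp: unit_cube_def)
          then show ?thesis
            using x by (simp add: mcnaughton_simps mcn_clamp_def coord_def L) linarith
        qed
      qed
    qed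
    consider "\<forall>i. a i = 0" | i where "a i > 0" | i where "a i < 0" by (meson linorder_neqE)
    then show ?case
    proof cases
      case 1
      show ?thesis
      proof (cases "b \<le> 0")
        case True
        show ?thesis unfolding mcn_clamp_def
          by (rule mcn_gen_congI[OF mv_generate.zero])
            (use 1 True in \<open>simp add: mcnaughton_simps L_def\<close>)
      next
        case False
        \<comment> \<open>Integrality enters here: a positive constant is at least 1, so it
          truncates to the top.\<close>
        then have "1 \<le> real_of_int b" by simp
        then show ?thesis unfolding mcn_clamp_def
          by (intro mcn_gen_congI[OF mv_generate.neg[OF mv_generate.zero]])
            (use 1 in \<open>simp add: mcnaughton_simps L_def\<close>)
      qed
    next
      case 2
      then show ?thesis using pos by blast
    next
      case 3
      let ?c = "\<lambda>i. - a i"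
      have L: "L ?c (1 - b) x = 1 - L a b x" for x
        by (simp add: L_def sum_negf)
      have "mcn_clamp (L ?c (1 - b)) \<in> mcn_gen"
        using pos[of ?c i] 3 by (simp add: N_def)
      then have "mv_neg mcnaughton (mcn_clamp (L ?c (1 - b))) \<in> mcn_gen" by (rule mv_generate.neg)
      then show ?thesis unfolding mcn_clamp_def
        by (rule mcn_gen_congI) (simp add: mcnaughton_simps L)
    qed
  qed
  moreover obtain a b where "p = L a b"
    using assms unfolding int_affine_def L_def by blast
  ultimately show ?thesis by simp
qed

section \<open>Max-min representation of continuous piecewise affine functions\<close>

lemma closure_UN_finite:
  assumes "finite I"
  shows "closure (\<Union>i\<in>I. S i) = (\<Union>i\<in>I. closure (S i))"
  using assms by (induction I rule: finite_induct) auto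

text \<open>Pieces in \<open>P0\<close> start at or below \<open>h\<close>; let \<open>s\<close> be
  the last time at which one of them, \<open>m\<close>, is still at or above \<open>h\<close>. If
  \<open>s < 1\<close>, then \<open>h\<close> continues along pieces starting strictly above it, and
  one of these, \<open>k\<close>, meets \<open>h\<close> at \<open>s\<close>. The affine difference
  of \<open>k\<close> and \<open>m\<close> is positive at 0 and nonpositive at \<open>s\<close>,
  hence negative afterwards, so \<open>h\<close> would drop below \<open>m\<close> beyond
  \<open>s\<close>, against the choice of \<open>s\<close>.\<close>

lemma piecewise_affine_chord:
  fixes h :: "real \<Rightarrow> real"
  assumes cont: "continuous_on {0..1} h" and fin: "finite P"
    and aff: "\<And>p t. p \<in> P \<Longrightarrow> p t = p 0 + t * (p 1 - p 0)"
    and pieces: "\<And>t. t \<in> {0..1} \<Longrightarrow> \<exists>p\<in>P. h t = p t"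
  shows "\<exists>p\<in>P. p 0 \<le> h 0 \<and> h 1 \<le> p 1"
proof -
  have pc: "continuous_on S p" if "p \<in> P" for p S
  proof -
    have "continuous_on S (\<lambda>t. p 0 + t * (p 1 - p 0))" by (intro continuous_intros)
    also have "(\<lambda>t. p 0 + t * (p 1 - p 0)) = p" by (rule ext) (rule aff[OF that, symmetric])
    finally show ?thesis .
  qed
  define P0 where "P0 = {p \<in> P. p 0 \<le> h 0}"
  define T where "T = (\<Union>p\<in>P0. {t \<in> {0..1}. h t \<le> p t})"
  have "compact T" unfolding T_def
  proof (rule compact_UN)
    show "finite P0" using fin by (simp add: P0_def)
    fix p assume "p \<in> P0"
    then have "closed {t \<in> {0..1}. h t \<le> p t}"
      by (intro continuous_on_closed_Collect_le cont pc) (auto simp: P0_def)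
    moreover have "bounded {t \<in> {0..1}. h t \<le> p t}"
      by (rule bounded_subset[of "{0..1}"]) auto
    ultimately show "compact {t \<in> {0..1}. h t \<le> p t}"
      by (simp add: compact_eq_bounded_closed)
  qed
  moreover have "0 \<in> T"
    using pieces[of 0] by (force simp: T_def P0_def)
  ultimately obtain s where s: "s \<in> T" "\<And>t. t \<in> T \<Longrightarrow> t \<le> s"
    using compact_attains_sup[of T] by blast
  obtain m where m: "m \<in> P" "m 0 \<le> h 0" "h s \<le> m s" and s01: "0 \<le> s" "s \<le> 1"
    using s(1) by (auto simp: T_def P0_def)
  show ?thesis
  proof (cases "s = 1")
    case True
    then show ?thesis using m by blast
  next
    case False
    then have s1: "s < 1" using s01 by simp
    define K where "K k = {t \<in> {s<..1}. h t = k t}" for k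
    have above: "p t < h t" if "p \<in> P" "p 0 \<le> h 0" "t \<in> {s<..1}" for p t
    proof (rule ccontr)
      assume "\<not> p t < h t"
      then have "t \<in> T" using that s01 by (auto simp: T_def P0_def)
      then show False using s(2) that by fastforce
    qed
    have "{s<..1} \<subseteq> (\<Union>k\<in>P - P0. K k)"
    proof
      fix t assume t: "t \<in> {s<..1}"
      then obtain k where k: "k \<in> P" "h t = k t" using pieces[of t] s01 by auto
      then have "k \<notin> P0" using above[of k t] t by (auto simp: P0_def)
      then show "t \<in> (\<Union>k\<in>P - P0. K k)" using k t by (auto simp: K_def)
    qed
    \<comment> \<open>There are finitely many pieces, so one of them agrees with \<open>h\<close> at
      times accumulating at \<open>s\<close> from the right, and by continuity at \<open>s\<close>
      too.\<close>
    then have "closure {s<..1} \<subseteq> closure (\<Union>k\<in>P - P0. K k)" by (rule closure_mono)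
    moreover have "s \<in> closure {s<..1}" using s1 by simp
    moreover have "closure (\<Union>k\<in>P - P0. K k) = (\<Union>k\<in>P - P0. closure (K k))"
      using fin by (intro closure_UN_finite) auto
    ultimately obtain k where "k \<in> P - P0" "s \<in> closure (K k)" by blast
    then have k: "k \<in> P" "h 0 < k 0" "s \<in> closure (K k)" by (auto simp: P0_def)
    have "closed {t \<in> {0..1}. h t - k t = 0}"
      by (intro continuous_closed_preimage_constant continuous_intros cont pc k closed_real_atLeastAtMost)
    then have "closed {t \<in> {0..1}. h t = k t}" by simp
    then have "closure (K k) \<subseteq> {t \<in> {0..1}. h t = k t}"
      using s01 by (intro closure_minimal) (auto simp: K_def)
    then have hs: "h s = k s" using k(3) by auto
    obtain t where t: "t \<in> K k" using k(3) by (metis closure_empty empty_iff ex_in_conv)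
    then have t': "s < t" "t \<le> 1" "h t = k t" by (auto simp: K_def)
    have mt: "m t < h t" using above[OF m(1,2), of t] t'(1,2) by simp
    \<comment> \<open>\<open>k\<close> exceeds \<open>h\<close> at 0 but equals it at
      \<open>s\<close>; strict positivity of \<open>s\<close> is what reveals the sign of
      \<open>\<beta>\<close>.\<close>
    have s0: "s > 0" using hs k(2) s01 by (cases "s = 0") auto
    define \<alpha> \<beta> where "\<alpha> = k 0 - m 0" and "\<beta> = (k 1 - k 0) - (m 1 - m 0)"
    have diff: "k r - m r = \<alpha> + r * \<beta>" for r
      using aff[OF k(1), of r] aff[OF m(1), of r] by (simp add: \<alpha>_def \<beta>_def algebra_simps)
    have "\<alpha> > 0" using k(2) m(2) by (simp add: \<alpha>_def)
    have "\<alpha> + s * \<beta> \<le> 0" using diff[of s] hs m(3) by simp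
    then have "s * \<beta> < 0" using \<open>\<alpha> > 0\<close> by simp
    then have "\<beta> < 0" using s0 by (simp add: mult_less_0_iff)
    then have "t * \<beta> < s * \<beta>" using t' by simp
    then have "k t < m t" using diff[of t] \<open>\<alpha> + s * \<beta> \<le> 0\<close> by simp
    then show ?thesis using mt t' by simp
  qed
qed

lemma convex_unit_cube: "convex unit_cube"
  unfolding convex_def unit_cube_def
  by (auto intro!: add_nonneg_nonneg convex_bound_le)

text \<open>
  Every point \<open>y\<close> contributes the minimum of the pieces that dominate \<open>f\<close> at \<open>y\<close>; this minimum is
  at least \<open>f y\<close> at \<open>y\<close>, and nowhere exceeds \<open>f\<close>. So \<open>f\<close> is the maximum of these minima.
\<close>
theorem mcnaughton_generated: "mv_generate mcnaughton (range coord) = carrier mcnaughton"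
proof (rule antisym)
  show "mcn_gen \<subseteq> carrier mcnaughton" using mcn_gen_subset by (simp add: mcnaughton_simps)
  show "carrier mcnaughton \<subseteq> (mcn_gen :: (real ^ 'n \<Rightarrow> real) set)"
  proof
    fix f :: "real ^ 'n \<Rightarrow> real" assume "f \<in> carrier mcnaughton"
    then have f: "f \<in> mcnaughton_functions" by (simp add: mcnaughton_simps)
    note fD = mcnaughton_functionsD[OF f]
    obtain P where P: "finite P" "\<And>p. p \<in> P \<Longrightarrow> int_affine p"
      "\<And>x. x \<in> unit_cube \<Longrightarrow> \<exists>p\<in>P. f x = p x"
      using mcnaughton_pieces[OF f] by blast
    define D where "D y = {p \<in> P. f y \<le> p y}" for y
    define \<phi> where "\<phi> Q = (\<lambda>x\<in>unit_cube. Min ((\<lambda>p. mcn_clamp p x) ` Q))"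
      for Q :: "(real ^ 'n \<Rightarrow> real) set"
    define F where "F = (\<lambda>x\<in>unit_cube. Max ((\<lambda>Q. \<phi> Q x) ` D ` unit_cube))"
    have D: "finite (D y)" "y \<in> unit_cube \<Longrightarrow> D y \<noteq> {}" for y
      using P(1) P(3)[of y] by (auto simp: D_def)
    \<comment> \<open>Infinitely many points share finitely many dominating sets, so the maximum is
      a finite one.\<close>
    have finD: "finite (D ` unit_cube)"
      by (rule finite_subset[of _ "Pow P"]) (use P(1) in \<open>auto simp: D_def\<close>)
    have "\<phi> Q \<in> mcn_gen" if "Q \<in> D ` unit_cube" for Q
      unfolding \<phi>_def using that D P(2)
      by (intro mcn_gen_Min clamp_in_mcn_gen) (auto simp: D_def)
    then have "F \<in> mcn_gen"
      unfolding F_def using finD zero_in_unit_cube by (intro mcn_gen_Max) auto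
    moreover have "F x = f x" if x: "x \<in> unit_cube" for x
    proof -
      have fx: "0 \<le> f x" "f x \<le> 1" using fD x by auto
      have "f x \<le> \<phi> (D x) x"
        using x D[of x] fx by (simp add: \<phi>_def) (auto simp: D_def mcn_clamp_def)
      moreover have "\<phi> (D y) x \<le> f x" if y: "y \<in> unit_cube" for y
      proof -
        \<comment> \<open>Along the segment from \<open>x\<close> to \<open>y\<close> some piece
          starts at or below \<open>f x\<close> and ends at or above \<open>f y\<close>. It belongs
          to \<open>D y\<close>, so it bounds the minimum at \<open>x\<close> by
          \<open>f x\<close>.\<close>
        define l where "l t = x + t *\<^sub>R (y - x)" for t :: real
        have l: "l t \<in> unit_cube" if "t \<in> {0..1}" for t
          using convexD_alt[OF convex_unit_cube x y, of t] that
          by (simp add: l_def algebra_simps)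
        have lc: "continuous_on {0..1} l" unfolding l_def by (intro continuous_intros)
        have "\<exists>q\<in>(\<lambda>p. p \<circ> l) ` P. q 0 \<le> (f \<circ> l) 0 \<and> (f \<circ> l) 1 \<le> q 1"
        proof (rule piecewise_affine_chord)
          show "continuous_on {0..1} (f \<circ> l)"
            using l by (intro continuous_on_compose lc continuous_on_subset[OF fD(4)]) auto
          show "\<exists>q\<in>(\<lambda>p. p \<circ> l) ` P. (f \<circ> l) t = q t" if "t \<in> {0..1}" for t
            using P(3)[OF l[OF that]] by auto
          show "q t = q 0 + t * (q 1 - q 0)" if q: "q \<in> (\<lambda>p. p \<circ> l) ` P" for q t
          proof -
            obtain p where "p \<in> P" "q = p \<circ> l" using q by blast
            then show ?thesis using int_affine_segment[OF P(2), of p x t y] by (simp add: l_def)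
          qed
        qed (use P in simp)
        then obtain p where p: "p \<in> P" "p x \<le> f x" "f y \<le> p y" by (auto simp: l_def)
        then have "\<phi> (D y) x \<le> mcn_clamp p x"
          using x D(1) by (simp add: \<phi>_def) (auto simp: D_def intro!: Min_le)
        also have "\<dots> \<le> f x" using p x fx by (simp add: mcn_clamp_def)
        finally show ?thesis .
      qed
      ultimately show ?thesis
        using x finD by (simp add: F_def) (intro Max_eqI order_antisym[of "\<phi> (D x) x"]; force)
    qed
    ultimately have "restrict f unit_cube \<in> mcn_gen" by (rule mcn_gen_congI)
    then show "f \<in> mcn_gen" using fD(1) by (simp add: extensional_restrict)
  qed
qed

section \<open>Germs at an interior point\<close>

lemma mcnaughton_le_iff:
  assumes "f \<in> mcnaughton_functions" "g \<in> mcnaughton_functions"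
  shows "mv_le mcnaughton f g \<longleftrightarrow> (\<forall>x\<in>unit_cube. f x \<le> g x)"
proof -
  have "mv_le mcnaughton f g \<longleftrightarrow> (\<forall>x\<in>unit_cube. min 1 (1 - f x + g x) = 1)"
    unfolding mv_le_def mcnaughton_simps
    by (auto simp: restrict_def fun_eq_iff)
  then show ?thesis by (auto simp: min_def)
qed

text \<open>Intersecting with the interior of the cube turns relative neighborhoods into genuine
  ones, so germs can be handled by the filter \<open>nhds w\<close>.\<close>

lemma germ_ideal_iff:
  assumes "w \<in> interior unit_cube"
  shows "f \<in> germ_ideal w \<longleftrightarrow> f \<in> mcnaughton_functions \<and> (\<forall>\<^sub>F y in nhds w. f y = 0)"
proof -
  have "(\<exists>U. openin (top_of_set unit_cube) U \<and> w \<in> U \<and> (\<forall>y\<in>U. f y = 0)) \<longleftrightarrow>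
      (\<exists>S. open S \<and> w \<in> S \<and> (\<forall>y\<in>S. f y = 0))"
  proof safe
    fix U assume U: "openin (top_of_set unit_cube) U" "w \<in> U" "\<forall>y\<in>U. f y = 0"
    then obtain S where "open S" "U = unit_cube \<inter> S" by (auto simp: openin_open)
    then show "\<exists>S. open S \<and> w \<in> S \<and> (\<forall>y\<in>S. f y = 0)"
      using U assms interior_subset
      by (intro exI[of _ "S \<inter> interior unit_cube"]) auto
  next
    fix S assume "open S" "w \<in> S" "\<forall>y\<in>S. f y = 0"
    then show "\<exists>U. openin (top_of_set unit_cube) U \<and> w \<in> U \<and> (\<forall>y\<in>U. f y = 0)"
      using assms interior_subset by (intro exI[of _ "unit_cube \<inter> S"]) auto
  qed
  then show ?thesis by (simp add: germ_ideal_def eventually_nhds)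
qed

lemma eventually_in_unit_cube:
  assumes "w \<in> interior unit_cube"
  shows "\<forall>\<^sub>F y in nhds w. y \<in> unit_cube"
  unfolding eventually_nhds
  using assms interior_subset by (intro exI[of _ "interior unit_cube"]) auto

lemma germ_ideal_proper:
  fixes w :: "real ^ 'n"
  assumes w: "w \<in> interior unit_cube"
  shows "mv_proper_ideal mcnaughton (germ_ideal w)"
proof -
  interpret mv_algebra "mcnaughton :: (real ^ 'n \<Rightarrow> real) mv_struct"
    by (rule mv_algebra_mcnaughton)
  note iff = germ_ideal_iff[OF w]
  note ev = eventually_in_unit_cube[OF w]
  have wc: "w \<in> unit_cube" using w interior_subset by blast
  show ?thesis
  proof unfold_locales
    have "f \<oplus>\<^bsub>mcnaughton\<^esub> g \<in> germ_ideal w" if "f \<in> germ_ideal w" "g \<in> germ_ideal w" for f g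
    proof -
      have "\<forall>\<^sub>F y in nhds w. f y = 0" "\<forall>\<^sub>F y in nhds w. g y = 0"
        using that iff by auto
      then have "\<forall>\<^sub>F y in nhds w. (f \<oplus>\<^bsub>mcnaughton\<^esub> g) y = 0"
        using ev by eventually_elim (simp add: mcnaughton_simps)
      then show ?thesis
        using that plus_closed[of f g] by (simp add: iff mcnaughton_simps(1))
    qed
    moreover have "f \<in> germ_ideal w"
      if "g \<in> germ_ideal w" "f \<in> carrier mcnaughton" "mv_le mcnaughton f g" for f g
    proof -
      have f: "f \<in> mcnaughton_functions" using that(2) by (simp add: mcnaughton_simps(1))
      have g: "g \<in> mcnaughton_functions" "\<forall>\<^sub>F y in nhds w. g y = 0" using that(1) iff by auto
      have "\<forall>\<^sub>F y in nhds w. f y = 0"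
        using ev g(2)
      proof eventually_elim
        case (elim y)
        then have "0 \<le> f y" "f y \<le> g y"
          using mcnaughton_functionsD(2)[OF f] mcnaughton_le_iff[OF f g(1)] that(3) by auto
        then show ?case using elim by simp
      qed
      then show ?thesis using f iff by simp
    qed
    moreover have "\<zero>\<^bsub>mcnaughton\<^esub> \<in> germ_ideal w"
      using ev by (simp add: iff mcnaughton_zero mcnaughton_simps(2) eventually_mono)
    ultimately show "mv_ideal_set mcnaughton (germ_ideal w)"
      unfolding mv_ideal_set_def by (auto simp: mcnaughton_simps(1) iff)
    show "\<sim>\<^bsub>mcnaughton\<^esub> \<zero>\<^bsub>mcnaughton\<^esub> \<notin> germ_ideal w"
    proof
      assume "\<sim>\<^bsub>mcnaughton\<^esub> \<zero>\<^bsub>mcnaughton\<^esub> \<in> germ_ideal w"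
      then have "(\<sim>\<^bsub>mcnaughton\<^esub> \<zero>\<^bsub>mcnaughton\<^esub>) w = (0 :: real)"
        using iff eventually_nhds_x_imp_x by blast
      then show False using wc by (simp add: mcnaughton_simps)
    qed
  qed
qed

section \<open>The germinal algebra and its endomorphisms\<close>

locale mcnaughton_germs =
  fixes w :: "real ^ 'n"
  assumes interior: "w \<in> interior unit_cube"

sublocale mcnaughton_germs \<subseteq> germs: mv_proper_ideal mcnaughton "germ_ideal w"
  by (rule germ_ideal_proper[OF interior])

context mcnaughton_germs
begin

abbreviation germ where "germ \<equiv> germs.cls"

abbreviation germ_alg where "germ_alg \<equiv> mv_quot mcnaughton (germ_ideal w)"

lemma germ_carrier: "carrier germ_alg = germ ` mcnaughton_functions"
  by (simp only: germs.quot_carrier mcnaughton_simps)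

lemma germ_eq_iff:
  assumes f: "f \<in> mcnaughton_functions" and g: "g \<in> mcnaughton_functions"
  shows "germ f = germ g \<longleftrightarrow> (\<forall>\<^sub>F y in nhds w. f y = g y)"
proof -
  note ev = eventually_in_unit_cube[OF interior]
  have c: "f \<in> carrier mcnaughton" "g \<in> carrier mcnaughton"
    using f g by (simp_all add: mcnaughton_simps(1))
  \<comment> \<open>On the cube \<open>d f g\<close> is the positive part of \<open>f - g\<close>;
    both positive parts vanish exactly where the functions agree.\<close>
  define d where "d f g = \<sim>\<^bsub>mcnaughton\<^esub> (\<sim>\<^bsub>mcnaughton\<^esub> f \<oplus>\<^bsub>mcnaughton\<^esub> g)"
    for f g :: "real ^ 'n \<Rightarrow> real"
  have d: "d f g y = max 0 (f y - g y)" if "y \<in> unit_cube" for f g y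
    using that by (simp add: d_def mcnaughton_simps min_def max_def)
  have dM: "d f g \<in> mcnaughton_functions" "d g f \<in> mcnaughton_functions"
    using c by (simp_all add: d_def flip: mcnaughton_simps(1))
  have "germ f = germ g \<longleftrightarrow> (\<forall>\<^sub>F y in nhds w. d f g y = 0 \<and> d g f y = 0)"
    using germs.cls_eq_iff[OF c] dM
    by (simp add: germ_ideal_iff[OF interior] eventually_conj_iff flip: d_def)
  also have "\<dots> \<longleftrightarrow> (\<forall>\<^sub>F y in nhds w. f y = g y)"
    by (intro eventually_subst eventually_mono[OF ev]) (auto simp: d max_def)
  finally show ?thesis .
qed

text \<open>
  An endomorphism is composition with the map \<open>g\<close> whose components represent the images of the
  coordinate germs: this holds on the generators of the McNaughton algebra, hence everywhere.
\<close>
lemma endomorphism_eq_composition: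
  assumes h: "h \<in> mv_hom germ_alg germ_alg"
    and g: "\<And>i. g i \<in> mcnaughton_functions" "\<And>i. h (germ (coord i)) = germ (g i)"
    and f: "f \<in> mcnaughton_functions"
  shows "\<exists>r\<in>mcnaughton_functions. h (germ f) = germ r \<and> (\<forall>\<^sub>F y in nhds w. r y = f (\<chi> i. g i y))"
proof -
  note ev = eventually_in_unit_cube[OF interior]
  note hD = mv_homD[OF h]
  \<comment> \<open>The composed points stay in the cube, where the restricted operations compute
    pointwise.\<close>
  have gc: "(\<chi> i. g i y) \<in> unit_cube" if "y \<in> unit_cube" for y
    using mcnaughton_functionsD(2,3)[OF g(1)] that by (simp add: unit_cube_def)
  have "f \<in> mcn_gen" using f mcnaughton_generated by (auto simp: mcnaughton_simps(1))
  then show ?thesis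
  proof (induction rule: mv_generate.induct)
    case (incl f)
    then obtain i where i: "f = coord i" by blast
    have "\<forall>\<^sub>F y in nhds w. g i y = coord i (\<chi> i. g i y)"
      using ev by eventually_elim (simp add: coord_def gc)
    then show ?case using g i by blast
  next
    case zero
    have "h (germ \<zero>\<^bsub>mcnaughton\<^esub>) = germ \<zero>\<^bsub>mcnaughton\<^esub>" using hD(2) by (simp only: germs.quot_zero)
    moreover have "\<forall>\<^sub>F y in nhds w. \<zero>\<^bsub>mcnaughton\<^esub> y = (\<zero>\<^bsub>mcnaughton\<^esub> (\<chi> i. g i y) :: real)"
      using ev by eventually_elim (simp add: mcnaughton_simps gc)
    ultimately show ?case using germs.zero_closed by (auto simp only: mcnaughton_simps(1))
  next
    case (plus f k)
    then obtain r s where r: "r \<in> mcnaughton_functions" "h (germ f) = germ r"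
        "\<forall>\<^sub>F y in nhds w. r y = f (\<chi> i. g i y)"
      and s: "s \<in> mcnaughton_functions" "h (germ k) = germ s"
        "\<forall>\<^sub>F y in nhds w. s y = k (\<chi> i. g i y)" by blast
    have c: "f \<in> carrier mcnaughton" "k \<in> carrier mcnaughton"
      "r \<in> carrier mcnaughton" "s \<in> carrier mcnaughton"
      using plus(1,2) r s mcn_gen_subset by (auto simp: mcnaughton_simps(1))
    have "h (germ (f \<oplus>\<^bsub>mcnaughton\<^esub> k)) = germ (r \<oplus>\<^bsub>mcnaughton\<^esub> s)"
      using c hD(3)[of "germ f" "germ k"] r(2) s(2) by (simp add: germs.quot_carrier germs.quot_plus)
    moreover have "\<forall>\<^sub>F y in nhds w. (r \<oplus>\<^bsub>mcnaughton\<^esub> s) y = (f \<oplus>\<^bsub>mcnaughton\<^esub> k) (\<chi> i. g i y)"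
      using ev r(3) s(3) by eventually_elim (simp add: mcnaughton_simps gc)
    ultimately show ?case using germs.plus_closed[OF c(3,4)] by (auto simp only: mcnaughton_simps(1))
  next
    case (neg f)
    then obtain r where r: "r \<in> mcnaughton_functions" "h (germ f) = germ r"
        "\<forall>\<^sub>F y in nhds w. r y = f (\<chi> i. g i y)" by blast
    have c: "f \<in> carrier mcnaughton" "r \<in> carrier mcnaughton"
      using neg(1) r mcn_gen_subset by (auto simp: mcnaughton_simps(1))
    have "h (germ (\<sim>\<^bsub>mcnaughton\<^esub> f)) = germ (\<sim>\<^bsub>mcnaughton\<^esub> r)"
      using c hD(4)[of "germ f"] r(2) by (simp add: germs.quot_carrier germs.quot_neg)
    moreover have "\<forall>\<^sub>F y in nhds w. (\<sim>\<^bsub>mcnaughton\<^esub> r) y = (\<sim>\<^bsub>mcnaughton\<^esub> f) (\<chi> i. g i y)"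
      using ev r(3) by eventually_elim (simp add: mcnaughton_simps gc)
    ultimately show ?case using germs.neg_closed[OF c(2)] by (auto simp only: mcnaughton_simps(1))
  qed
qed

lemma germ_hopfian: "mv_hopfian germ_alg"
proof (rule mv_algebra.mv_hopfianI[OF germs.quot_mv_algebra])
  fix h a assume h: "h \<in> mv_hom germ_alg germ_alg" and surj: "h ` carrier germ_alg = carrier germ_alg"
    and a: "a \<in> carrier germ_alg" "h a = \<zero>\<^bsub>germ_alg\<^esub>"
  note hD = mv_homD[OF h]
  note ev = eventually_in_unit_cube[OF interior]
  have coordM: "coord i \<in> mcnaughton_functions" for i :: 'n
    by (simp add: coord_eq_clamp clamp_mcnaughton int_affine_coord)
  have zero: "\<zero>\<^bsub>germ_alg\<^esub> = germ (\<lambda>x\<in>unit_cube. 0)"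
    by (simp only: germs.quot_zero mcnaughton_simps)
  have zero_iff: "germ r = \<zero>\<^bsub>germ_alg\<^esub> \<longleftrightarrow> (\<forall>\<^sub>F y in nhds w. r y = 0)"
    if "r \<in> mcnaughton_functions" for r
    unfolding zero germ_eq_iff[OF that mcnaughton_zero]
    by (intro eventually_subst eventually_mono[OF ev]) simp
  have "\<exists>r\<in>mcnaughton_functions. h (germ (coord i)) = germ r" for i
    using hD(1)[of "germ (coord i)"] coordM by (auto simp: germ_carrier)
  then obtain g where g: "\<And>i. g i \<in> mcnaughton_functions" "\<And>i. h (germ (coord i)) = germ (g i)"
    by metis
  \<comment> \<open>One representative per coordinate turns the germ data into an actual map on the
    cube; any other choice would agree with it near \<open>w\<close>.\<close>
  define G where "G y = (\<chi> i. g i y)" for y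
  note comp = endomorphism_eq_composition[OF h g, folded G_def]
  have G_cont: "continuous_on unit_cube G"
    unfolding G_def using mcnaughton_functionsD(4)[OF g(1)] by (intro continuous_intros)
  have wc: "w \<in> unit_cube" using interior interior_subset by blast
  have Gw: "G w = w"
  proof (rule ccontr)
    assume "G w \<noteq> w"
    then obtain p where p: "int_affine p" "p w < 0" "0 < p (G w)"
      using separating_int_affine[of w "G w"] by metis
    define f where "f = mcn_clamp p"
    have f: "f \<in> mcnaughton_functions" using clamp_mcnaughton p(1) by (simp add: f_def)
    have "open {y. p y < 0}"
      using int_affine_continuous[OF p(1), of UNIV] by (intro open_Collect_less) auto
    then have "\<forall>\<^sub>F y in nhds w. p y < 0" using p(2) by (auto simp: eventually_nhds)
    then have "\<forall>\<^sub>F y in nhds w. f y = 0"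
      using ev by eventually_elim (simp add: f_def mcn_clamp_def)
    then have "h (germ f) = \<zero>\<^bsub>germ_alg\<^esub>" using zero_iff[OF f] hD(2) by simp
    moreover obtain r where r: "r \<in> mcnaughton_functions" "h (germ f) = germ r"
      "\<forall>\<^sub>F y in nhds w. r y = f (G y)" using comp[OF f] by blast
    ultimately have "\<forall>\<^sub>F y in nhds w. r y = 0" using zero_iff by simp
    \<comment> \<open>Every neighborhood of \<open>w\<close> contains \<open>w\<close>, so germ
      equalities may be evaluated there; this is how vanishing near \<open>w\<close> reaches the
      point \<open>G w\<close>.\<close>
    then have "r w = 0" by (rule eventually_nhds_x_imp_x)
    then have "f (G w) = 0" using eventually_nhds_x_imp_x[OF r(3)] by simp
    moreover have "G w \<in> unit_cube"
      using mcnaughton_functionsD(2,3)[OF g(1) wc] by (simp add: unit_cube_def G_def)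
    ultimately show False using p(3) by (simp add: f_def mcn_clamp_def max_def min_def split: if_splits)
  qed
  have "\<exists>f\<in>mcnaughton_functions. h (germ f) = germ (coord i)" for i
  proof -
    have "germ (coord i) \<in> h ` carrier germ_alg" using surj coordM by (simp add: germ_carrier)
    then show ?thesis by (auto simp: germ_carrier)
  qed
  \<comment> \<open>Preimages of the coordinate germs are the components of the local left inverse
    of \<open>G\<close>.\<close>
  then obtain f where f: "\<And>i. f i \<in> mcnaughton_functions" "\<And>i. h (germ (f i)) = germ (coord i)"
    by metis
  have "\<forall>\<^sub>F y in nhds w. f i (G y) = y $ i" for i
  proof -
    obtain r where r: "r \<in> mcnaughton_functions" "h (germ (f i)) = germ r"
      "\<forall>\<^sub>F y in nhds w. r y = f i (G y)" using comp[OF f(1)] by blast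
    then have "\<forall>\<^sub>F y in nhds w. r y = coord i y" using germ_eq_iff[OF r(1) coordM] f(2) r(2) by metis
    then show ?thesis using r(3) ev by eventually_elim (simp add: coord_def)
  qed
  \<comment> \<open>The index type is finite, so the neighborhoods for the separate coordinates have
    a common one.\<close>
  then have left_inv: "\<forall>\<^sub>F y in nhds w. \<forall>i. f i (G y) = y $ i" by (rule eventually_all_finite)
  obtain k where k: "k \<in> mcnaughton_functions" "a = germ k" using a(1) by (auto simp: germ_carrier)
  obtain r where r: "r \<in> mcnaughton_functions" "h (germ k) = germ r"
    "\<forall>\<^sub>F y in nhds w. r y = k (G y)" using comp[OF k(1)] by blast
  then have "\<forall>\<^sub>F y in nhds w. r y = 0" using a(2) k(2) zero_iff by simp
  \<comment> \<open>A single neighborhood is taken inside the interior as well, so that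
    \<open>G\<close> is continuous on it.\<close>
  then have "\<forall>\<^sub>F y in nhds w. y \<in> interior unit_cube \<and> (\<forall>i. f i (G y) = y $ i) \<and> k (G y) = 0"
    using r(3) left_inv eventually_nhds_in_open[OF open_interior interior]
    by eventually_elim auto
  then obtain U where U: "open U" "w \<in> U" "U \<subseteq> interior unit_cube"
    "\<And>y i. y \<in> U \<Longrightarrow> f i (G y) = y $ i" "\<And>y. y \<in> U \<Longrightarrow> k (G y) = 0"
    unfolding eventually_nhds by blast
  have "inj_on G U"
  proof (rule inj_onI)
    fix x y assume xy: "x \<in> U" "y \<in> U" "G x = G y"
    have "x $ i = y $ i" for i using U(4)[OF xy(1), of i] U(4)[OF xy(2), of i] xy(3) by simp
    then show "x = y" by (simp add: vec_eq_iff)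
  qed
  moreover have "continuous_on U G"
    using continuous_on_subset[OF G_cont] U(3) interior_subset by blast
  ultimately have "open (G ` U)" using invariance_of_domain U(1) by blast
  moreover have "w \<in> G ` U" using Gw U(2) by (metis imageI)
  ultimately have "\<forall>\<^sub>F y in nhds w. k y = 0"
    unfolding eventually_nhds using U(5) by blast
  then show "a = \<zero>\<^bsub>germ_alg\<^esub>" using zero_iff k by simp
qed

end

theorem theorem4p1:
  shows "(\<forall>A :: 'a mv_struct. mv_algebra A \<and> mv_simple A \<longrightarrow> mv_hopfian A)
    \<and> (\<forall>A :: 'b mv_struct. mv_algebra A \<and> mv_finitely_generated A \<and>
          finite {P. mv_prime_ideal A P} \<longrightarrow> mv_hopfian A)
    \<and> (\<forall>w :: real ^ 'n. rational_point w \<and> w \<in> interior unit_cube \<longrightarrow>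
          mv_algebra (mv_quot mcnaughton (germ_ideal w)) \<and>
          mv_hopfian (mv_quot mcnaughton (germ_ideal w)))"
proof (intro conjI allI impI; elim conjE)
  fix w :: "real ^ 'n" assume "w \<in> interior unit_cube"
  then interpret mcnaughton_germs w by unfold_locales
  show "mv_algebra (mv_quot mcnaughton (germ_ideal w))" by (rule germs.quot_mv_algebra)
  show "mv_hopfian (mv_quot mcnaughton (germ_ideal w))" by (rule germ_hopfian)
qed (auto intro: mv_algebra.mv_simple_hopfian mv_algebra.mv_finite_spectrum_hopfian)

end
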